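(* Let $\Phi:\mathfrak g\to\mathfrak h$ be a filtration-respecting map of strongly filtered differential graded Lie algebras (with odd brackets), and let $x_0\in\mathcal{MC}(\mathfrak g/F_1\mathfrak g)$, $x_0':=\Phi(x_0)\in\mathcal{MC}(\mathfrak h/F_1\mathfrak h)$. If $\Phi$ induces isomorphisms $$\Phi:H^\bullet\big(F_m\mathfrak g/F_{m+1}\mathfrak g,\{x_0,-\}\big)\longrightarrow H^\bullet\big(F_m\mathfrak h/F_{m+1}\mathfrak h,\{\Phi(x_0),-\}\big)$$ for all $m\ge1$, then the induced map on moduli spaces of quantizations $$\Phi:\widetilde{\mathcal{MC}}|_{x_0}(\mathfrak g)\to\widetilde{\mathcal{MC}}|_{x_0'}(\mathfrak h)$$ is a bijection.
   Context: The ground field $\mathbb K$ has characteristic zero. A dg Lie algebra here is a $\mathbb Z/2$-graded space $\mathfrak g$ with odd differential $d$ and odd bracket satisfying (BV sign conventions) $\{a,b\}=(-1)^{|a||b|}\{b,a\}$, $\{a,\{b,c\}\}=(-1)^{|a|+1}\{\{a,b\},c\}+(-1)^{(|a|+1)(|b|+1)}\{b,\{a,c\}\}$, $d\{a,b\}=-\{da,b\}-(-1)^{|a|}\{a,db\}$; i.e. its parity shift is an ordinary dg Lie superalgebra. A strong filtration on $\mathfrak g$ is a complete Hausdorff decreasing filtration $\mathfrak g=F_0\mathfrak g\supset F_1\mathfrak g\supset\cdots$ with $\{F_p\mathfrak g,F_q\mathfrak g\}\subset F_{p+q}\mathfrak g$ and $d(F_p\mathfrak g)\subset F_{p+1}\mathfrak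 g$ for all $p,q\ge0$. $\mathcal{MC}(\mathfrak g)=\{x\in\mathfrak g^0:dx+\frac12\{x,x\}=0\}$. $F_1\mathfrak g^1$, a group under the Baker-Campbell-Hausdorff product $\star$ of the bracket, acts on $\mathcal{MC}(\mathfrak g)$ by $$\exp(y)\cdot x=x+\sum_{i\ge0}\frac1{(i+1)!}\{y,-\}^i(dy+\{y,x\}).$$ For $x_0\in\mathcal{MC}(\mathfrak g/F_1\mathfrak g)$ (where the differential is zero, so the condition is $\{x_0,x_0\}=0$), $\mathcal{MC}|_{x_0}(\mathfrak g)$ is the fiber over $x_0$ of $\mathcal{MC}(\mathfrak g)\to\mathcal{MC}(\mathfrak g/F_1\mathfrak g)$ (quantizations of $x_0$), and $\widetilde{\mathcal{MC}}|_{x_0}(\mathfrak g)$ is its quotient by the action of $F_1\mathfrak g^1$. The adjoint map $\{x_0,-\}$ is a well-defined differential on each $F_m\mathfrak g/F_{m+1}\mathfrak g$. *)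

theory Defs
  imports Complex_Main "HOL-Library.Set_Algebras" "HOL-Library.Z2"
begin

text \<open>Parities are elements of the field \<^typ>\<open>bit\<close> with two elements, so degree arithmetic is
  arithmetic mod 2; \<open>ksign e v\<close> is \<open>(-1)^e v\<close>.\<close>

definition ksign :: "bit \<Rightarrow> 'a::ab_group_add \<Rightarrow> 'a" where
  "ksign e v = (if e = 0 then v else - v)"

record ('k, 'a) dgla =
  scl :: "'k \<Rightarrow> 'a \<Rightarrow> 'a"
  gr :: "bit \<Rightarrow> 'a set"
  dif :: "'a \<Rightarrow> 'a"
  brk :: "'a \<Rightarrow> 'a \<Rightarrow> 'a"

record ('k, 'a) filtered_dgla = "('k, 'a) dgla" +
  fil :: "nat \<Rightarrow> 'a set"

text \<open>The underlying space is the whole type. The bracket is odd, so \<open>{g\<^sup>i, g\<^sup>j}\<close> lies in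
  \<open>g\<^sup>(i+j+1)\<close>.\<close>

locale odd_dgla = vector_space "scl A"
  for A :: "('k::field_char_0, 'a::ab_group_add, 'z) dgla_scheme" +
  assumes gr_subspace: "\<And>i. subspace (gr A i)"
    and gr_sum: "gr A 0 + gr A 1 = UNIV"
    and gr_disjoint: "gr A 0 \<inter> gr A 1 = {0}"
    and dif_linear: "Vector_Spaces.linear (scl A) (scl A) (dif A)"
    and brk_linear_left: "\<And>b. Vector_Spaces.linear (scl A) (scl A) (\<lambda>a. brk A a b)"
    and brk_linear_right: "\<And>a. Vector_Spaces.linear (scl A) (scl A) (brk A a)"
    and dif_odd: "\<And>i a. a \<in> gr A i \<Longrightarrow> dif A a \<in> gr A (i + 1)"
    and dif_dif: "\<And>a. dif A (dif A a) = 0"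
    and brk_odd: "\<And>i j a b. a \<in> gr A i \<Longrightarrow> b \<in> gr A j \<Longrightarrow> brk A a b \<in> gr A (i + j + 1)"
    and brk_sym: "\<And>i j a b. a \<in> gr A i \<Longrightarrow> b \<in> gr A j \<Longrightarrow>
      brk A a b = ksign (i * j) (brk A b a)"
    and jacobi: "\<And>i j a b c. a \<in> gr A i \<Longrightarrow> b \<in> gr A j \<Longrightarrow>
      brk A a (brk A b c) =
        ksign (i + 1) (brk A (brk A a b) c) + ksign ((i + 1) * (j + 1)) (brk A b (brk A a c))"
    and dif_brk: "\<And>i a b. a \<in> gr A i \<Longrightarrow>
      dif A (brk A a b) = - brk A (dif A a) b - ksign i (brk A a (dif A b))"

text \<open>Convergence and infinite sums in the topology defined by a filtration \<open>F\<close>.\<close>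

definition fil_converges :: "(nat \<Rightarrow> 'a::ab_group_add set) \<Rightarrow> (nat \<Rightarrow> 'a) \<Rightarrow> 'a \<Rightarrow> bool" where
  "fil_converges F s l \<longleftrightarrow> (\<forall>p. \<exists>N. \<forall>n\<ge>N. s n - l \<in> F p)"

definition fil_cauchy :: "(nat \<Rightarrow> 'a::ab_group_add set) \<Rightarrow> (nat \<Rightarrow> 'a) \<Rightarrow> bool" where
  "fil_cauchy F s \<longleftrightarrow> (\<forall>p. \<exists>N. \<forall>m\<ge>N. \<forall>n\<ge>N. s m - s n \<in> F p)"

definition fil_suminf :: "(nat \<Rightarrow> 'a::ab_group_add set) \<Rightarrow> (nat \<Rightarrow> 'a) \<Rightarrow> 'a" where
  "fil_suminf F t = (THE l. fil_converges F (\<lambda>n. \<Sum>i<n. t i) l)"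

text \<open>\<open>fil_graded\<close> says that each \<open>F\<^sub>p\<close> is a graded subspace.\<close>

locale strongly_filtered_dgla = odd_dgla A
  for A :: "('k::field_char_0, 'a::ab_group_add, 'z) filtered_dgla_scheme" +
  assumes fil_subspace: "\<And>p. subspace (fil A p)"
    and fil_graded: "\<And>p a b. a \<in> gr A 0 \<Longrightarrow> b \<in> gr A 1 \<Longrightarrow> a + b \<in> fil A p \<Longrightarrow>
      a \<in> fil A p \<and> b \<in> fil A p"
    and fil_0: "fil A 0 = UNIV"
    and fil_decreasing: "\<And>p. fil A (Suc p) \<subseteq> fil A p"
    and fil_hausdorff: "(\<Inter>p. fil A p) = {0}"
    and fil_complete: "\<And>s. fil_cauchy (fil A) s \<Longrightarrow> \<exists>l. fil_converges (fil A) s l"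
    and fil_brk: "\<And>p q a b. a \<in> fil A p \<Longrightarrow> b \<in> fil A q \<Longrightarrow> brk A a b \<in> fil A (p + q)"
    and fil_dif: "\<And>p a. a \<in> fil A p \<Longrightarrow> dif A a \<in> fil A (p + 1)"

locale filtered_dgla_map =
  G: strongly_filtered_dgla G + H: strongly_filtered_dgla H +
  Vector_Spaces.linear "scl G" "scl H" f
  for G :: "('k::field_char_0, 'a::ab_group_add, 'y) filtered_dgla_scheme"
    and H :: "('k, 'b::ab_group_add, 'z) filtered_dgla_scheme"
    and f :: "'a \<Rightarrow> 'b" +
  assumes map_gr: "\<And>i a. a \<in> gr G i \<Longrightarrow> f a \<in> gr H i"
    and map_dif: "\<And>a. f (dif G a) = dif H (f a)"
    and map_brk: "\<And>a b. f (brk G a b) = brk H (f a) (f b)"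
    and map_fil: "\<And>p a. a \<in> fil G p \<Longrightarrow> f a \<in> fil H p"

text \<open>
  The quotient \<open>U/W\<close> is the set of cosets \<open>u +o W\<close> with \<open>u \<in> U\<close>. Its addition is the Minkowski sum,
  so the same definition applies again when the elements of \<open>U\<close> are themselves cosets.
  A map \<open>f\<close> induces the map \<open>C \<mapsto> f ` C + W'\<close> into cosets of \<open>W'\<close>, which sends \<open>u +o W\<close> to
  \<open>f u +o W'\<close> for additive \<open>f\<close> with \<open>f ` W \<subseteq> W'\<close>.
\<close>

definition quot :: "'a::plus set \<Rightarrow> 'a set \<Rightarrow> 'a set set" where
  "quot U W = (\<lambda>u. u +o W) ` U"

definition induced :: "('a \<Rightarrow> 'b::plus) \<Rightarrow> 'b set \<Rightarrow> 'a set \<Rightarrow> 'b set" where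
  "induced f W' C = f ` C + W'"

text \<open>The bracket of two cosets, with values in cosets of \<open>W\<close>.\<close>

definition quot_brk ::
  "('k, 'a::ab_group_add, 'z) dgla_scheme \<Rightarrow> 'a set \<Rightarrow> 'a set \<Rightarrow> 'a set \<Rightarrow> 'a set" where
  "quot_brk A W X Y = {brk A x y | x y. x \<in> X \<and> y \<in> Y} + W"

text \<open>
  \<open>gr_cohomology A x0 m i\<close> is the parity \<open>i\<close> part of the cohomology of \<open>F\<^sub>m/F\<^sub>m\<^sub>+\<^sub>1\<close> with differential
  \<open>{x0,-}\<close>, where \<open>x0\<close> is a coset of \<open>F\<^sub>1\<close>. The zero of \<open>F\<^sub>m/F\<^sub>m\<^sub>+\<^sub>1\<close> is the coset \<open>F\<^sub>m\<^sub>+\<^sub>1\<close>.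
\<close>

definition gr_chains ::
  "('k, 'a::ab_group_add, 'z) filtered_dgla_scheme \<Rightarrow> nat \<Rightarrow> bit \<Rightarrow> 'a set set" where
  "gr_chains A m i = quot (fil A m \<inter> gr A i) (fil A (m + 1))"

definition gr_cocycles ::
  "('k, 'a::ab_group_add, 'z) filtered_dgla_scheme \<Rightarrow> 'a set \<Rightarrow> nat \<Rightarrow> bit \<Rightarrow> 'a set set" where
  "gr_cocycles A x0 m i =
    {c \<in> gr_chains A m i. quot_brk A (fil A (m + 1)) x0 c = fil A (m + 1)}"

definition gr_coboundaries ::
  "('k, 'a::ab_group_add, 'z) filtered_dgla_scheme \<Rightarrow> 'a set \<Rightarrow> nat \<Rightarrow> bit \<Rightarrow> 'a set set" where
  "gr_coboundaries A x0 m i = quot_brk A (fil A (m + 1)) x0 ` gr_chains A m (i + 1)"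

definition gr_cohomology ::
  "('k, 'a::ab_group_add, 'z) filtered_dgla_scheme \<Rightarrow> 'a set \<Rightarrow> nat \<Rightarrow> bit \<Rightarrow> 'a set set set" where
  "gr_cohomology A x0 m i = quot (gr_cocycles A x0 m i) (gr_coboundaries A x0 m i)"

text \<open>The map \<open>H\<^sup>i(F\<^sub>m g/F\<^sub>m\<^sub>+\<^sub>1 g, {x0,-}) \<rightarrow> H\<^sup>i(F\<^sub>m h/F\<^sub>m\<^sub>+\<^sub>1 h, {x0',-})\<close> induced by \<open>f : g \<rightarrow> h\<close>; only the
  target \<open>h\<close> and \<open>x0'\<close> enter the formula.\<close>

definition gr_cohomology_map ::
  "('k, 'b::ab_group_add, 'z) filtered_dgla_scheme \<Rightarrow> ('a \<Rightarrow> 'b) \<Rightarrow> 'b set \<Rightarrow> nat \<Rightarrow> bit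
    \<Rightarrow> 'a set set \<Rightarrow> 'b set set" where
  "gr_cohomology_map H f x0' m i =
    induced (induced f (fil H (m + 1))) (gr_coboundaries H x0' m i)"

definition MC :: "('k::field_char_0, 'a::ab_group_add, 'z) dgla_scheme \<Rightarrow> 'a set" where
  "MC A = {x \<in> gr A 0. dif A x + scl A (1 / 2) (brk A x x) = 0}"

text \<open>\<open>MC_classical A\<close> is \<open>MC(g/F\<^sub>1 g)\<close>. The differential of \<open>g/F\<^sub>1 g\<close> vanishes, and the zero of this
  quotient is the coset \<open>F\<^sub>1\<close>.\<close>

definition MC_classical :: "('k, 'a::ab_group_add, 'z) filtered_dgla_scheme \<Rightarrow> 'a set set" where
  "MC_classical A = {X \<in> quot (gr A 0) (fil A 1). quot_brk A (fil A 1) X X = fil A 1}"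

definition MC_fiber ::
  "('k::field_char_0, 'a::ab_group_add, 'z) filtered_dgla_scheme \<Rightarrow> 'a set \<Rightarrow> 'a set" where
  "MC_fiber A x0 = {x \<in> MC A. x +o fil A 1 = x0}"

definition gauge_act ::
  "('k::field_char_0, 'a::ab_group_add, 'z) filtered_dgla_scheme \<Rightarrow> 'a \<Rightarrow> 'a \<Rightarrow> 'a" where
  "gauge_act A y x = x + fil_suminf (fil A)
    (\<lambda>i. scl A (1 / fact (i + 1)) ((brk A y ^^ i) (dif A y + brk A y x)))"

definition gauge_rel ::
  "('k::field_char_0, 'a::ab_group_add, 'z) filtered_dgla_scheme \<Rightarrow> ('a \<times> 'a) set" where
  "gauge_rel A = {(x, gauge_act A y x) | x y. x \<in> MC A \<and> y \<in> fil A 1 \<inter> gr A 1}"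

definition MC_moduli ::
  "('k::field_char_0, 'a::ab_group_add, 'z) filtered_dgla_scheme \<Rightarrow> 'a set \<Rightarrow> 'a set set" where
  "MC_moduli A x0 = MC_fiber A x0 // gauge_rel A"

text \<open>For a map \<open>f\<close> of filtered dg Lie algebras this sends the orbit of \<open>x\<close> to the orbit of \<open>f x\<close>.\<close>

definition moduli_map ::
  "('k::field_char_0, 'b::ab_group_add, 'z) filtered_dgla_scheme \<Rightarrow> ('a \<Rightarrow> 'b) \<Rightarrow> 'a set \<Rightarrow> 'b set" where
  "moduli_map H f C = gauge_rel H `` (f ` C)"

end

(*
  Gauge equivalence. After adjoining an even element \<delta> with {\<delta>, x} = dx, the gauge action becomes the
  linear action of exp {y,-} on \<delta> + x. That a composite of two exponentials is again one (needed
  already for "same orbit" to be an equivalence relation) is proved without free Lie algebras: a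
  power series w(s) with exp w(s) = exp(sy) exp(sz) solves \<phi>(ad w) w' = y + exp(sy) z, where
  \<phi>(u) = (e^u - 1)/u. This equation determines the coefficients of w recursively, and the coefficient
  of s^n lies in F_n, so that w(1) converges.

  Bijectivity is obstruction theory along the filtration. If x satisfies the Maurer-Cartan equation
  mod F_n, its curvature is a cocycle mod F_(n+1) by the Bianchi identity. Its image is a
  coboundary, so by injectivity on cohomology it is one itself; surjectivity lets one match the image
  of x with the prescribed solution up to gauge, so x improves to order n+1. For two solutions with gauge equivalent images the
  same is done for the gauge transformation; the freedom left over comes from elements d_x k, which
  fix x. The corrections in step n lie in F_n, so the infinite composites converge.
*)
theory Submission
  imports Defs "HOL-Library.Function_Algebras" "HOL-Library.Product_Plus"
begin

text \<open>Strength of the filtration makes the problem linear: for e in F_n with n \<ge> 1, both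
  de and {e,e} lie in F_(n+1), so modulo F_(n+1) a correction e changes the curvature of x by {x,e}
  alone, and here x may be replaced by any lift of \<open>x0\<close>. Each step therefore sees only
  the graded complexes of the hypothesis. Even elements are candidate solutions, odd ones are
  curvatures and gauge parameters; so existence uses injectivity in odd and surjectivity in even
  degree, and uniqueness uses the opposite parities. Infinite composites of gauge transformations
  need control of a single accumulated exponent. If y lies in F_n and z only in F_1, then exp y exp
  z has an exponent congruent to y + z modulo F_(n+1), because every surviving commutator contains y
  and a further factor from F_1. Identities between exponentials are proved for formal series in s,
  where each coefficient is a finite sum and a linear differential equation has a unique solution in
  characteristic zero; topology enters only when s is set to 1.\<close>

section \<open>Reindexing of finite sums, causal fixed points, limits in filtered groups\<close>

lemma sum_apply: "(\<Sum>i\<in>A. f i) x = (\<Sum>i\<in>A. f i x :: 'b::comm_monoid_add)"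
  by (induction A rule: infinite_finite_induct) auto

lemma sum_nested_triangle:
  fixes g :: "nat \<Rightarrow> nat \<Rightarrow> 'b::comm_monoid_add"
  shows "(\<Sum>i\<le>n. \<Sum>j\<le>n - i. g i j) = (\<Sum>k\<le>n. \<Sum>i\<le>k. g i (k - i))"
proof -
  have "(SIGMA i:{..n}. {..n - i}) = {(i, j). i + j \<le> n}"
    by auto
  then show ?thesis
    by (simp add: sum.Sigma flip: sum.triangle_reindex_eq)
qed

lemma sum_nested_swap:
  fixes g :: "nat \<Rightarrow> nat \<Rightarrow> 'b::comm_monoid_add"
  shows "(\<Sum>i\<le>n. \<Sum>j\<le>n - i. g i j) = (\<Sum>j\<le>n. \<Sum>i\<le>n - j. g i j)"
proof -
  have "(\<Sum>i\<le>n. \<Sum>j\<le>n - i. g i j) = (\<Sum>i\<le>n. \<Sum>j | j \<in> {..n} \<and> j \<le> n - i. g i j)"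
    by (intro sum.cong) auto
  also have "\<dots> = (\<Sum>j\<le>n. \<Sum>i | i \<in> {..n} \<and> j \<le> n - i. g i j)"
    by (rule sum.swap_restrict) auto
  also have "\<dots> = (\<Sum>j\<le>n. \<Sum>i\<le>n - j. g i j)"
    by (intro sum.cong) auto
  finally show ?thesis .
qed

text \<open>Entry i of the iterates of \<open>T\<close> is constant from step i + 1 on, because
  entry n of \<open>T a\<close> reads only entries below n; \<open>w\<close> collects these stable
  entries. The sets \<open>S i\<close> carry side conditions along, and causality is asked only of
  sequences that satisfy them.\<close>

lemma causal_fixpoint:
  fixes T :: "(nat \<Rightarrow> 'v) \<Rightarrow> nat \<Rightarrow> 'v"
  assumes d: "\<And>i. d i \<in> S i"
    and T: "\<And>a i. (\<And>j. a j \<in> S j) \<Longrightarrow> T a i \<in> S i"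
    and causal: "\<And>a b n. (\<And>i. a i \<in> S i) \<Longrightarrow> (\<And>i. b i \<in> S i) \<Longrightarrow> (\<And>i. i < n \<Longrightarrow> a i = b i)
      \<Longrightarrow> T a n = T b n"
  obtains w where "\<And>i. w i \<in> S i" "T w = w"
proof
  have S: "(T ^^ k) d i \<in> S i" for k i
    by (induction k arbitrary: i) (auto intro: d T)
  have stable: "k \<le> m \<Longrightarrow> i < k \<Longrightarrow> (T ^^ m) d i = (T ^^ k) d i" for k m i
  proof (induction k arbitrary: m i)
    case (Suc k)
    obtain m' where m: "m = Suc m'"
      using Suc.prems by (cases m) auto
    show ?case
      unfolding m funpow.simps o_def
    proof (rule causal)
      show "(T ^^ m') d j = (T ^^ k) d j" if "j < i" for j
        by (rule Suc.IH) (use Suc.prems that m in linarith)+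
    qed (rule S)+
  qed simp
  define w where "w i = (T ^^ Suc i) d i" for i
  show w: "w i \<in> S i" for i
    unfolding w_def by (rule S)
  have "T w n = w n" for n
  proof -
    have "T w n = T ((T ^^ n) d) n"
    proof (rule causal[OF w S])
      show "w j = (T ^^ n) d j" if "j < n" for j
        using that stable[of "Suc j" n j] unfolding w_def by simp
    qed
    then show ?thesis by (simp add: w_def)
  qed
  then show "T w = w" ..
qed

lemma fil_converges_unique:
  fixes F :: "nat \<Rightarrow> 'a::ab_group_add set"
  assumes diff: "\<And>p a b. a \<in> F p \<Longrightarrow> b \<in> F p \<Longrightarrow> a - b \<in> F p" and hausdorff: "(\<Inter>p. F p) = {0}"
    and "fil_converges F s l" "fil_converges F s l'"
  shows "l = l'"
proof -
  have "l - l' \<in> F p" for p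
  proof -
    obtain N N' where N: "\<And>n. n \<ge> N \<Longrightarrow> s n - l \<in> F p" "\<And>n. n \<ge> N' \<Longrightarrow> s n - l' \<in> F p"
      using assms(3,4) unfolding fil_converges_def by metis
    have "(s (max N N') - l') - (s (max N N') - l) \<in> F p"
      by (intro diff N) simp_all
    then show ?thesis by simp
  qed
  then have "l - l' \<in> (\<Inter>p. F p)" by blast
  then show ?thesis unfolding hausdorff by simp
qed

lemma fil_suminf_eqI:
  fixes F :: "nat \<Rightarrow> 'a::ab_group_add set"
  assumes "\<And>p a b. a \<in> F p \<Longrightarrow> b \<in> F p \<Longrightarrow> a - b \<in> F p" "(\<Inter>p. F p) = {0}"
    and "fil_converges F (\<lambda>n. \<Sum>i<n. t i) l"
  shows "fil_suminf F t = l"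
  unfolding fil_suminf_def using assms
  by (intro the_equality fil_converges_unique[OF assms(1,2)])

text \<open>Passing to the limit in \<open>s k - s n\<close> with k \<ge> n keeps the error in
  \<open>F n\<close>. Later arguments use this explicit rate rather than mere convergence.\<close>

lemma fil_limit_exists:
  fixes F :: "nat \<Rightarrow> 'a::ab_group_add set"
  assumes zero: "\<And>p. 0 \<in> F p" and diff: "\<And>p a b. a \<in> F p \<Longrightarrow> b \<in> F p \<Longrightarrow> a - b \<in> F p"
    and decreasing: "\<And>p. F (Suc p) \<subseteq> F p"
    and complete: "\<And>s. fil_cauchy F s \<Longrightarrow> \<exists>l. fil_converges F s l"
    and s: "\<And>n. s (Suc n) - s n \<in> F n"
  obtains l where "\<And>n. l - s n \<in> F n"
proof -
  have add: "a + b \<in> F p" if "a \<in> F p" "b \<in> F p" for a b p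
    using diff[OF that(1) diff[OF zero that(2)]] by simp
  have step: "s m - s n \<in> F n" if "n \<le> m" for m n
    using that
  proof (induction m rule: dec_induct)
    case (step m)
    have "s (Suc m) - s m \<in> F n"
      using lift_Suc_antimono_le[of F n m] decreasing s[of m] step.hyps by blast
    from add[OF this step.IH] show ?case by simp
  qed (simp add: zero)
  have "fil_cauchy F s"
    unfolding fil_cauchy_def
  proof (intro allI exI impI)
    fix p m n :: nat assume "p \<le> m" "p \<le> n"
    then have "(s m - s p) - (s n - s p) \<in> F p"
      by (intro diff step)
    then show "s m - s n \<in> F p" by simp
  qed
  then obtain l where l: "fil_converges F s l" using complete by blast
  have "l - s n \<in> F n" for n
  proof -
    obtain N where N: "\<And>k. k \<ge> N \<Longrightarrow> s k - l \<in> F n"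
      using l unfolding fil_converges_def by blast
    have "(s (max N n) - s n) - (s (max N n) - l) \<in> F n"
      by (intro diff step N) auto
    then show ?thesis by simp
  qed
  then show ?thesis using that by blast
qed

section \<open>Exponentials and the Baker-Campbell-Hausdorff product\<close>

text \<open>\<open>L\<close> is a closed Lie algebra acting on the whole space by derivations.
  Identities are imposed only where the acting element lies in \<open>L\<close>, so that the space
  may also contain even elements, whose identities carry signs.\<close>

locale complete_leibniz = vector_space scale
  for scale :: "'k::field_char_0 \<Rightarrow> 'v::ab_group_add \<Rightarrow> 'v" (infixr \<open>*s\<close> 75) +
  fixes br :: "'v \<Rightarrow> 'v \<Rightarrow> 'v" and F :: "nat \<Rightarrow> 'v set" and L :: "'v set"
  assumes br_linear_left: "\<And>b. Vector_Spaces.linear scale scale (\<lambda>a. br a b)"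
    and br_linear_right: "\<And>a. Vector_Spaces.linear scale scale (br a)"
    and F_subspace: "\<And>p. subspace (F p)"
    and F_0: "F 0 = UNIV"
    and F_Suc: "\<And>p. F (Suc p) \<subseteq> F p"
    and F_hausdorff: "(\<Inter>p. F p) = {0}"
    and F_complete: "\<And>s. fil_cauchy F s \<Longrightarrow> \<exists>l. fil_converges F s l"
    and br_F: "\<And>p q a b. a \<in> F p \<Longrightarrow> b \<in> F q \<Longrightarrow> br a b \<in> F (p + q)"
    and L_subspace: "subspace L"
    and L_closed: "\<And>s l. (\<And>n. s n \<in> L) \<Longrightarrow> fil_converges F s l \<Longrightarrow> l \<in> L"
    and br_L: "\<And>a b. a \<in> L \<Longrightarrow> b \<in> L \<Longrightarrow> br a b \<in> L"
    and br_self: "\<And>a. a \<in> L \<Longrightarrow> br a a = 0"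
    and leibniz: "\<And>y a b. y \<in> L \<Longrightarrow> br y (br a b) = br (br y a) b + br a (br y b)"
begin

lemmas br_hom_left = br_linear_left[folded module_hom_eq_linear]
  and br_hom_right = br_linear_right[folded module_hom_eq_linear]

lemmas br_simps =
  module_hom.add[OF br_hom_left] module_hom.diff[OF br_hom_left] module_hom.neg[OF br_hom_left]
  module_hom.scale[OF br_hom_left] module_hom.zero[OF br_hom_left] module_hom.sum[OF br_hom_left]
  module_hom.add[OF br_hom_right] module_hom.diff[OF br_hom_right] module_hom.neg[OF br_hom_right]
  module_hom.scale[OF br_hom_right] module_hom.zero[OF br_hom_right] module_hom.sum[OF br_hom_right]

lemmas F_zero = subspace_0[OF F_subspace]
  and F_add = subspace_add[OF F_subspace]
  and F_diff = subspace_diff[OF F_subspace]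
  and F_neg = subspace_neg[OF F_subspace]
  and F_scale = subspace_scale[OF F_subspace]
  and F_sum = subspace_sum[OF F_subspace]

lemmas F_mem = F_zero F_add F_diff F_neg F_scale F_sum

lemmas L_mem = subspace_0[OF L_subspace] subspace_add[OF L_subspace] subspace_diff[OF L_subspace]
  subspace_scale[OF L_subspace] subspace_sum[OF L_subspace] subspace_neg[OF L_subspace]

lemma F_antimono: "p \<le> q \<Longrightarrow> F q \<subseteq> F p"
  using lift_Suc_antimono_le[of F] F_Suc by blast

lemma F_mono: "a \<in> F q \<Longrightarrow> p \<le> q \<Longrightarrow> a \<in> F p"
  using F_antimono by blast

lemma br_F_ge: "a \<in> F p \<Longrightarrow> b \<in> F q \<Longrightarrow> r \<le> p + q \<Longrightarrow> br a b \<in> F r"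
  using br_F F_mono by blast

lemma eq_if_diff_F: "(\<And>p. a - b \<in> F p) \<Longrightarrow> a = b"
  using F_hausdorff by (metis INT_I right_minus_eq singletonD)

abbreviation ev :: "(nat \<Rightarrow> 'v) \<Rightarrow> 'v" where
  "ev \<equiv> fil_suminf F"

lemma converges_if_approx:
  assumes "\<And>n. l - s n \<in> F n"
  shows "fil_converges F s l"
  unfolding fil_converges_def
proof (intro allI exI impI)
  fix p n :: nat assume "p \<le> n"
  then have "l - s n \<in> F p" using assms F_mono by blast
  then have "- (l - s n) \<in> F p" by (rule F_mem)
  then show "s n - l \<in> F p" by simp
qed

lemmas limit_exists = fil_limit_exists[where F = F, OF F_zero F_diff F_Suc F_complete]

lemma ev_eqI: "(\<And>n. l - (\<Sum>i<n. a i) \<in> F n) \<Longrightarrow> ev a = l"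
  by (rule fil_suminf_eqI[OF F_diff F_hausdorff converges_if_approx])

lemma ev_approx:
  assumes "\<And>i. a i \<in> F i"
  shows "ev a - (\<Sum>i<n. a i) \<in> F n"
proof -
  obtain l where l: "\<And>n. l - (\<Sum>i<n. a i) \<in> F n"
    by (rule limit_exists[of "\<lambda>n. \<Sum>i<n. a i"]) (auto simp: assms)
  then have "ev a = l" by (rule ev_eqI)
  then show ?thesis using l by simp
qed

lemma ev_in_subspace:
  assumes "subspace U" "\<And>s l. (\<And>n. s n \<in> U) \<Longrightarrow> fil_converges F s l \<Longrightarrow> l \<in> U"
    and "\<And>i. a i \<in> F i" "\<And>i. a i \<in> U"
  shows "ev a \<in> U"
proof (rule assms(2))
  show "fil_converges F (\<lambda>n. \<Sum>i<n. a i) (ev a)"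
    by (intro converges_if_approx ev_approx assms(3))
  show "(\<Sum>i<n. a i) \<in> U" for n
    by (intro subspace_sum assms(1,4))
qed

section \<open>Calculus of formal power series with the convolution bracket\<close>

text \<open>A curve \<open>a\<close> is the formal power series \<open>\<Sum> a\<^sub>n s\<^sup>n\<close>; \<open>ev a\<close> is its value at \<open>s = 1\<close>.\<close>

definition curve_br :: "(nat \<Rightarrow> 'v) \<Rightarrow> (nat \<Rightarrow> 'v) \<Rightarrow> nat \<Rightarrow> 'v" (infixl \<open>\<odot>\<close> 70) where
  "(a \<odot> b) n = (\<Sum>i\<le>n. br (a i) (b (n - i)))"

definition curve_scale :: "'k \<Rightarrow> (nat \<Rightarrow> 'v) \<Rightarrow> nat \<Rightarrow> 'v" where
  "curve_scale c a n = c *s a n"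

definition curve_deriv :: "(nat \<Rightarrow> 'v) \<Rightarrow> nat \<Rightarrow> 'v" where
  "curve_deriv a n = of_nat (Suc n) *s a (Suc n)"

definition const_curve :: "'v \<Rightarrow> nat \<Rightarrow> 'v" where
  "const_curve x n = (if n = 0 then x else 0)"

definition lin_curve :: "'v \<Rightarrow> nat \<Rightarrow> 'v" where
  "lin_curve x n = (if n = 1 then x else 0)"

lemma curve_vector_space: "vector_space curve_scale"
  by standard (rule ext, simp add: curve_scale_def algebra_simps)+

interpretation curve: vector_space curve_scale
  by (rule curve_vector_space)

lemma curve_br_add_left: "(a + b) \<odot> c = a \<odot> c + b \<odot> c"
  and curve_br_add_right: "a \<odot> (b + c) = a \<odot> b + a \<odot> c"
  by (auto simp: curve_br_def fun_eq_iff br_simps sum.distrib)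

lemma curve_br_scale_left: "curve_scale r a \<odot> c = curve_scale r (a \<odot> c)"
  and curve_br_scale_right: "a \<odot> curve_scale r c = curve_scale r (a \<odot> c)"
  by (auto simp: curve_br_def curve_scale_def fun_eq_iff br_simps scale_sum_right)

lemma curve_br_zero_left: "0 \<odot> c = 0" and curve_br_zero_right: "c \<odot> 0 = 0"
  by (auto simp: curve_br_def fun_eq_iff br_simps)

lemma curve_br_sum_right: "c \<odot> (\<Sum>i\<in>A. f i) = (\<Sum>i\<in>A. c \<odot> f i)"
  by (induction A rule: infinite_finite_induct)
    (simp_all only: sum.infinite sum.empty sum.insert curve_br_add_right curve_br_zero_right not_False_eq_True)

lemma curve_br_diff_left: "(a - b) \<odot> c = a \<odot> c - b \<odot> c"
  by (auto simp: curve_br_def fun_eq_iff br_simps sum_subtractf)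

lemma curve_br_cong:
  "(\<And>i. i \<le> n \<Longrightarrow> a i = a' i) \<Longrightarrow> (\<And>i. i \<le> n \<Longrightarrow> b i = b' i) \<Longrightarrow> (a \<odot> b) n = (a' \<odot> b') n"
  unfolding curve_br_def by (intro sum.cong arg_cong2[where f = br]) auto

lemma curve_br_order:
  assumes "\<And>i. i < p \<Longrightarrow> a i = 0" "\<And>i. i < q \<Longrightarrow> b i = 0" "n < p + q"
  shows "(a \<odot> b) n = 0"
  unfolding curve_br_def
proof (rule sum.neutral, rule ballI)
  fix i assume "i \<in> {..n}"
  then have "i < p \<or> n - i < q" using assms(3) by auto
  then show "br (a i) (b (n - i)) = 0" using assms by (auto simp: br_simps)
qed

lemma curve_leibniz:
  assumes w: "\<And>i. w i \<in> L"
  shows "w \<odot> (a \<odot> b) = (w \<odot> a) \<odot> b + a \<odot> (w \<odot> b)"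
proof
  fix n
  have "(w \<odot> (a \<odot> b)) n = (\<Sum>i\<le>n. \<Sum>j\<le>n - i. br (br (w i) (a j)) (b (n - i - j)))
     + (\<Sum>i\<le>n. \<Sum>j\<le>n - i. br (a j) (br (w i) (b (n - i - j))))"
    by (simp add: curve_br_def br_simps leibniz w sum.distrib)
  also have "(\<Sum>i\<le>n. \<Sum>j\<le>n - i. br (br (w i) (a j)) (b (n - i - j))) = ((w \<odot> a) \<odot> b) n"
  proof -
    have "((w \<odot> a) \<odot> b) n = (\<Sum>m\<le>n. \<Sum>i\<le>m. br (br (w i) (a (m - i))) (b (n - i - (m - i))))"
      by (auto simp: curve_br_def br_simps intro!: sum.cong)
    then show ?thesis by (simp only: sum_nested_triangle)
  qed
  also have "(\<Sum>i\<le>n. \<Sum>j\<le>n - i. br (a j) (br (w i) (b (n - i - j)))) = (a \<odot> (w \<odot> b)) n"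
    by (subst sum_nested_swap) (simp add: curve_br_def br_simps add.commute)
  finally show "(w \<odot> (a \<odot> b)) n = ((w \<odot> a) \<odot> b + a \<odot> (w \<odot> b)) n" by simp
qed

lemma curve_deriv_br: "curve_deriv (a \<odot> b) = curve_deriv a \<odot> b + a \<odot> curve_deriv b"
proof
  fix n
  have "curve_deriv (a \<odot> b) n = (\<Sum>i\<le>Suc n. of_nat (Suc n) *s br (a i) (b (Suc n - i)))"
    by (simp add: curve_deriv_def curve_br_def scale_sum_right del: sum.atMost_Suc)
  also have "\<dots> = (\<Sum>i\<le>Suc n. br (of_nat i *s a i) (b (Suc n - i)))
      + (\<Sum>i\<le>Suc n. br (a i) (of_nat (Suc n - i) *s b (Suc n - i)))"
    unfolding sum.distrib[symmetric]
  proof (rule sum.cong)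
    fix i assume "i \<in> {..Suc n}"
    then have "(of_nat (Suc n) :: 'k) = of_nat i + of_nat (Suc n - i)"
      by (simp flip: of_nat_add)
    then show "of_nat (Suc n) *s br (a i) (b (Suc n - i)) =
      br (of_nat i *s a i) (b (Suc n - i)) + br (a i) (of_nat (Suc n - i) *s b (Suc n - i))"
      by (simp only: br_simps scale_left_distrib)
  qed simp
  also have "(\<Sum>i\<le>Suc n. br (of_nat i *s a i) (b (Suc n - i))) = (curve_deriv a \<odot> b) n"
    unfolding sum.atMost_Suc_shift curve_br_def curve_deriv_def by (simp add: br_simps)
  also have "(\<Sum>i\<le>Suc n. br (a i) (of_nat (Suc n - i) *s b (Suc n - i))) = (a \<odot> curve_deriv b) n"
    unfolding sum.atMost_Suc curve_br_def curve_deriv_def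
    by (simp add: br_simps Suc_diff_le)
  finally show "curve_deriv (a \<odot> b) n = (curve_deriv a \<odot> b + a \<odot> curve_deriv b) n" by simp
qed

lemma curve_deriv_scale: "curve_deriv (curve_scale c a) = curve_scale c (curve_deriv a)"
  by (auto simp: curve_deriv_def curve_scale_def fun_eq_iff mult.commute)

text \<open>Coefficient m + 1 is coefficient m of \<open>u \<odot> a\<close> divided by m + 1, and
  the latter depends only on coefficients up to m. Products of exponentials are later identified in
  this way.\<close>

lemma curve_ode_unique:
  assumes a: "curve_deriv a = u \<odot> a" and b: "curve_deriv b = u \<odot> b" and "a 0 = b 0"
  shows "a = b"
proof
  fix n show "a n = b n"
  proof (induction n rule: less_induct)
    case (less n)
    show ?case
    proof (cases n)
      case (Suc m)
      have "curve_deriv a m = curve_deriv b m"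
        unfolding a b by (rule curve_br_cong) (auto intro: less simp: Suc)
      then show ?thesis
        unfolding curve_deriv_def Suc by (simp del: of_nat_Suc)
    qed (use assms in simp)
  qed
qed

section \<open>Exponentials of series and their derivatives\<close>

definition expterm :: "(nat \<Rightarrow> 'v) \<Rightarrow> nat \<Rightarrow> (nat \<Rightarrow> 'v) \<Rightarrow> nat \<Rightarrow> 'v" where
  "expterm w k a = curve_scale (1 / fact k) (((\<odot>) w ^^ k) a)"

text \<open>Cutting the sum at k \<le> n makes every coefficient finite. If \<open>w 0 = 0\<close>,
  the omitted terms vanish, since each bracket with \<open>w\<close> raises the order in s.\<close>

definition curve_exp :: "(nat \<Rightarrow> 'v) \<Rightarrow> (nat \<Rightarrow> 'v) \<Rightarrow> nat \<Rightarrow> 'v" where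
  "curve_exp w a n = (\<Sum>k\<le>n. expterm w k a n)"

text \<open>\<open>dexp w\<close> is \<open>\<phi>(ad w) w'\<close> for \<open>\<phi>(u) = (e\<^sup>u - 1) / u\<close>, so that
  \<open>d/ds e\<^sup>w = \<phi>(ad w) w' e\<^sup>w\<close>.\<close>

definition dexpterm :: "(nat \<Rightarrow> 'v) \<Rightarrow> nat \<Rightarrow> nat \<Rightarrow> 'v" where
  "dexpterm w j = curve_scale (1 / fact (Suc j)) (((\<odot>) w ^^ j) (curve_deriv w))"

definition dexp :: "(nat \<Rightarrow> 'v) \<Rightarrow> nat \<Rightarrow> 'v" where
  "dexp w n = (\<Sum>j\<le>n. dexpterm w j n)"

lemma expterm_0 [simp]: "expterm w 0 a = a"
  by (simp add: expterm_def)

lemma curve_br_expterm: "w \<odot> expterm w k a = curve_scale (of_nat (Suc k)) (expterm w (Suc k) a)"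
  by (simp add: expterm_def curve_br_scale_right del: of_nat_Suc)

lemma curve_br_dexpterm: "w \<odot> dexpterm w j = curve_scale (of_nat (Suc (Suc j))) (dexpterm w (Suc j))"
  by (simp add: dexpterm_def curve_br_scale_right del: of_nat_Suc)

lemma funpow_curve_br_order:
  assumes "w 0 = 0" "n < k"
  shows "((\<odot>) w ^^ k) a n = 0"
  using assms(2)
proof (induction k arbitrary: n)
  case (Suc k)
  have "(w \<odot> ((\<odot>) w ^^ k) a) n = 0"
    using Suc assms(1) by (intro curve_br_order[where p = 1 and q = k]) auto
  then show ?case by simp
qed simp

lemma expterm_order: "w 0 = 0 \<Longrightarrow> n < k \<Longrightarrow> expterm w k a n = 0"
  and dexpterm_order: "w 0 = 0 \<Longrightarrow> n < k \<Longrightarrow> dexpterm w k n = 0"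
  by (simp_all add: expterm_def dexpterm_def curve_scale_def funpow_curve_br_order)

text \<open>As \<open>\<alpha> j\<close> and \<open>\<beta> j\<close> have order at least j in s,
  all truncated sums extend to the common bound n; pairs with j + l > n contribute nothing, and the
  rest is regrouped by j + l = k.\<close>

lemma curve_cauchy_product:
  assumes \<alpha>: "\<And>j n. n < j \<Longrightarrow> \<alpha> j n = 0" and \<beta>: "\<And>j n. n < j \<Longrightarrow> \<beta> j n = 0"
  shows "(\<Sum>k\<le>n. \<Sum>j\<le>k. (\<alpha> j \<odot> \<beta> (k - j)) n) = ((\<lambda>m. \<Sum>j\<le>m. \<alpha> j m) \<odot> (\<lambda>m. \<Sum>j\<le>m. \<beta> j m)) n"
proof -
  have "((\<lambda>m. \<Sum>j\<le>m. \<alpha> j m) \<odot> (\<lambda>m. \<Sum>j\<le>m. \<beta> j m)) n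
     = ((\<lambda>m. \<Sum>j\<le>n. \<alpha> j m) \<odot> (\<lambda>m. \<Sum>j\<le>n. \<beta> j m)) n"
    by (intro curve_br_cong sum.mono_neutral_left) (auto simp: \<alpha> \<beta>)
  also have "\<dots> = (\<Sum>i\<le>n. \<Sum>j\<le>n. \<Sum>l\<le>n. br (\<alpha> j i) (\<beta> l (n - i)))"
    unfolding curve_br_def br_simps by (intro sum.cong refl sum.swap)
  also have "\<dots> = (\<Sum>j\<le>n. \<Sum>i\<le>n. \<Sum>l\<le>n. br (\<alpha> j i) (\<beta> l (n - i)))"
    by (rule sum.swap)
  also have "\<dots> = (\<Sum>j\<le>n. \<Sum>l\<le>n. (\<alpha> j \<odot> \<beta> l) n)"
    unfolding curve_br_def by (intro sum.cong refl sum.swap)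
  also have "\<dots> = (\<Sum>j\<le>n. \<Sum>l\<le>n - j. (\<alpha> j \<odot> \<beta> l) n)"
  proof (rule sum.cong[OF refl])
    fix j
    have "(\<alpha> j \<odot> \<beta> l) n = 0" if "\<not> l \<le> n - j" for l
      using that by (intro curve_br_order[where p = j and q = l]) (auto simp: \<alpha> \<beta>)
    then show "(\<Sum>l\<le>n. (\<alpha> j \<odot> \<beta> l) n) = (\<Sum>l\<le>n - j. (\<alpha> j \<odot> \<beta> l) n)"
      by (intro sum.mono_neutral_right) auto
  qed
  also have "\<dots> = (\<Sum>k\<le>n. \<Sum>j\<le>k. (\<alpha> j \<odot> \<beta> (k - j)) n)"
    by (rule sum_nested_triangle)
  finally show ?thesis ..
qed

text \<open>With an auxiliary variable t put A = \<Sum> \<open>\<alpha> i\<close> t^i, and B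
  likewise. The hypotheses say A' = w \<odot> A + c and B' = w \<odot> B, and the conclusion is
  coefficient k of (A \<odot> B)' = w \<odot> (A \<odot> B) + c \<odot> B. The case c = 0 makes
  exponentials multiplicative, the case c = \<open>curve_deriv w\<close> differentiates
  them.\<close>

lemma divided_power_leibniz:
  assumes w: "\<And>i. w i \<in> L"
    and \<alpha>: "\<And>i. w \<odot> \<alpha> i = curve_scale (of_nat (Suc i)) (\<alpha> (Suc i)) - (if i = 0 then c else 0)"
    and \<beta>: "\<And>i. w \<odot> \<beta> i = curve_scale (of_nat (Suc i)) (\<beta> (Suc i))"
  shows "w \<odot> (\<Sum>i\<le>k. \<alpha> i \<odot> \<beta> (k - i))
    = curve_scale (of_nat (Suc k)) (\<Sum>i\<le>Suc k. \<alpha> i \<odot> \<beta> (Suc k - i)) - c \<odot> \<beta> k"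
proof -
  have "w \<odot> (\<Sum>i\<le>k. \<alpha> i \<odot> \<beta> (k - i)) =
    (\<Sum>i\<le>k. curve_scale (of_nat (Suc i)) (\<alpha> (Suc i) \<odot> \<beta> (k - i)) - (if i = 0 then c \<odot> \<beta> k else 0)
       + curve_scale (of_nat (Suc (k - i))) (\<alpha> i \<odot> \<beta> (Suc (k - i))))"
    unfolding curve_br_sum_right curve_leibniz[of w, OF w] \<alpha> \<beta>
    by (intro sum.cong refl)
      (auto simp: curve_br_diff_left curve_br_scale_left curve_br_scale_right curve_br_zero_left
        simp del: of_nat_Suc)
  also have "\<dots> = (\<Sum>i\<le>k. curve_scale (of_nat (Suc i)) (\<alpha> (Suc i) \<odot> \<beta> (k - i)))
    + (\<Sum>i\<le>k. curve_scale (of_nat (Suc (k - i))) (\<alpha> i \<odot> \<beta> (Suc (k - i)))) - c \<odot> \<beta> k"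
    by (simp add: sum.distrib sum_subtractf del: of_nat_Suc)
  \<comment> \<open>Both sums are extended to i \<le> k + 1, the new terms having weight 0, so that
    the weights i and k + 1 - i add up to k + 1.\<close>
  also have "(\<Sum>i\<le>k. curve_scale (of_nat (Suc i)) (\<alpha> (Suc i) \<odot> \<beta> (k - i)))
     = (\<Sum>i\<le>Suc k. curve_scale (of_nat i) (\<alpha> i \<odot> \<beta> (Suc k - i)))"
    unfolding sum.atMost_Suc_shift by (simp del: of_nat_Suc)
  also have "(\<Sum>i\<le>k. curve_scale (of_nat (Suc (k - i))) (\<alpha> i \<odot> \<beta> (Suc (k - i))))
     = (\<Sum>i\<le>Suc k. curve_scale (of_nat (Suc k - i)) (\<alpha> i \<odot> \<beta> (Suc k - i)))"
    unfolding sum.atMost_Suc by (simp add: Suc_diff_le del: of_nat_Suc)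
  also have "(\<Sum>i\<le>Suc k. curve_scale (of_nat i) (\<alpha> i \<odot> \<beta> (Suc k - i)))
      + (\<Sum>i\<le>Suc k. curve_scale (of_nat (Suc k - i)) (\<alpha> i \<odot> \<beta> (Suc k - i)))
     = curve_scale (of_nat (Suc k)) (\<Sum>i\<le>Suc k. \<alpha> i \<odot> \<beta> (Suc k - i))"
    unfolding curve.scale_sum_right sum.distrib[symmetric]
  proof (intro sum.cong refl)
    fix i assume "i \<in> {..Suc k}"
    then have "(of_nat (Suc k) :: 'k) = of_nat i + of_nat (Suc k - i)"
      by (simp flip: of_nat_add)
    then show "curve_scale (of_nat i) (\<alpha> i \<odot> \<beta> (Suc k - i))
      + curve_scale (of_nat (Suc k - i)) (\<alpha> i \<odot> \<beta> (Suc k - i))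
      = curve_scale (of_nat (Suc k)) (\<alpha> i \<odot> \<beta> (Suc k - i))"
      by (simp only: curve.scale_left_distrib)
  qed
  finally show ?thesis .
qed

lemma expterm_br:
  assumes w: "\<And>i. w i \<in> L"
  shows "expterm w k (a \<odot> b) = (\<Sum>i\<le>k. expterm w i a \<odot> expterm w (k - i) b)"
proof (induction k)
  case (Suc k)
  have "curve_scale (of_nat (Suc k)) (expterm w (Suc k) (a \<odot> b))
     = w \<odot> (\<Sum>i\<le>k. expterm w i a \<odot> expterm w (k - i) b)"
    unfolding Suc[symmetric] curve_br_expterm ..
  also have "\<dots> = curve_scale (of_nat (Suc k)) (\<Sum>i\<le>Suc k. expterm w i a \<odot> expterm w (Suc k - i) b)"
    by (subst divided_power_leibniz[where c = 0])
      (auto simp: w curve_br_expterm curve_br_zero_left simp del: of_nat_Suc)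
  finally show ?case
    by (simp del: of_nat_Suc)
qed simp

lemma curve_exp_br:
  assumes w: "\<And>i. w i \<in> L" and w0: "w 0 = 0"
  shows "curve_exp w (a \<odot> b) = curve_exp w a \<odot> curve_exp w b"
proof
  fix n
  have "curve_exp w (a \<odot> b) n = (\<Sum>k\<le>n. \<Sum>i\<le>k. (expterm w i a \<odot> expterm w (k - i) b) n)"
    by (simp add: curve_exp_def expterm_br w sum_apply)
  also have "\<dots> = (curve_exp w a \<odot> curve_exp w b) n"
    unfolding curve_exp_def[abs_def] by (rule curve_cauchy_product) (auto simp: expterm_order w0)
  finally show "curve_exp w (a \<odot> b) n = (curve_exp w a \<odot> curve_exp w b) n" .
qed

text \<open>Here \<Sum> \<open>\<alpha> i\<close> t^i is (e^(t ad w) - 1) / ad w applied to w', and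
  the identity is coefficient k in t of the s-derivative of e^(t ad w) a. The numerator has no
  constant term, whence the zero at i = 0 and the index shift.\<close>

lemma curve_deriv_expterm:
  assumes w: "\<And>i. w i \<in> L"
  defines "\<alpha> \<equiv> \<lambda>i. if i = 0 then 0 else dexpterm w (i - 1)"
  shows "curve_deriv (expterm w k a) =
    expterm w k (curve_deriv a) + (\<Sum>i\<le>k. \<alpha> i \<odot> expterm w (k - i) a)"
proof (induction k)
  case 0
  have "\<alpha> 0 = 0" by (simp add: \<alpha>_def)
  then show ?case by (simp only: curve_br_zero_left expterm_0 atMost_0 sum.insert sum.empty finite.emptyI empty_iff not_False_eq_True if_True diff_zero add_0_right)
next
  case (Suc k)
  have \<alpha>: "w \<odot> \<alpha> i = curve_scale (of_nat (Suc i)) (\<alpha> (Suc i)) - (if i = 0 then curve_deriv w else 0)"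
    for i
  proof (cases i)
    case 0
    then show ?thesis by (simp add: \<alpha>_def curve_br_zero_right dexpterm_def)
  next
    case (Suc j)
    then show ?thesis by (simp add: \<alpha>_def curve_br_dexpterm del: of_nat_Suc)
  qed
  have "curve_scale (of_nat (Suc k)) (curve_deriv (expterm w (Suc k) a))
     = curve_deriv (w \<odot> expterm w k a)"
    by (simp only: curve_br_expterm curve_deriv_scale)
  also have "\<dots> = curve_deriv w \<odot> expterm w k a + w \<odot> expterm w k (curve_deriv a)
      + w \<odot> (\<Sum>i\<le>k. \<alpha> i \<odot> expterm w (k - i) a)"
    unfolding curve_deriv_br Suc curve_br_add_right by (simp add: add.assoc)
  also have "w \<odot> (\<Sum>i\<le>k. \<alpha> i \<odot> expterm w (k - i) a)
     = curve_scale (of_nat (Suc k)) (\<Sum>i\<le>Suc k. \<alpha> i \<odot> expterm w (Suc k - i) a)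
       - curve_deriv w \<odot> expterm w k a"
    by (rule divided_power_leibniz[OF w \<alpha> curve_br_expterm])
  also have "curve_deriv w \<odot> expterm w k a + w \<odot> expterm w k (curve_deriv a)
      + (curve_scale (of_nat (Suc k)) (\<Sum>i\<le>Suc k. \<alpha> i \<odot> expterm w (Suc k - i) a)
       - curve_deriv w \<odot> expterm w k a)
     = curve_scale (of_nat (Suc k)) (expterm w (Suc k) (curve_deriv a)
        + (\<Sum>i\<le>Suc k. \<alpha> i \<odot> expterm w (Suc k - i) a))"
    unfolding curve_br_expterm curve.scale_right_distrib by (simp only: algebra_simps)
  finally show ?case
    by (simp only: curve.scale_cancel_left of_nat_eq_0_iff) blast
qed

lemma curve_deriv_exp:
  assumes w: "\<And>i. w i \<in> L" and w0: "w 0 = 0"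
  shows "curve_deriv (curve_exp w a) = dexp w \<odot> curve_exp w a + curve_exp w (curve_deriv a)"
proof
  fix n
  define \<alpha> where "\<alpha> \<equiv> \<lambda>i. if i = 0 then 0 else dexpterm w (i - 1)"
  have "curve_deriv (curve_exp w a) n = (\<Sum>k\<le>Suc n. curve_deriv (expterm w k a) n)"
    unfolding curve_deriv_def curve_exp_def by (rule scale_sum_right)
  also have "\<dots> = (\<Sum>k\<le>Suc n. expterm w k (curve_deriv a) n)
     + (\<Sum>k\<le>Suc n. \<Sum>i\<le>k. (\<alpha> i \<odot> expterm w (k - i) a) n)"
    unfolding curve_deriv_expterm[of w, OF w] \<alpha>_def by (simp only: plus_fun_apply sum.distrib sum_apply)
  also have "(\<Sum>k\<le>Suc n. expterm w k (curve_deriv a) n) = curve_exp w (curve_deriv a) n"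
    by (simp add: curve_exp_def expterm_order w0)
  \<comment> \<open>As \<open>\<alpha> 0 = 0\<close>, shifting i and k by one absorbs the extra
    degree needed because coefficient n of a derivative comes from coefficient n + 1.\<close>
  also have "(\<Sum>k\<le>Suc n. \<Sum>i\<le>k. (\<alpha> i \<odot> expterm w (k - i) a) n)
     = (\<Sum>k\<le>n. \<Sum>i\<le>k. (dexpterm w i \<odot> expterm w (k - i) a) n)"
    unfolding sum.atMost_Suc_shift[of _ n] sum.atMost_Suc_shift
    by (simp add: \<alpha>_def curve_br_zero_left)
  also have "\<dots> = (dexp w \<odot> curve_exp w a) n"
    unfolding curve_exp_def[abs_def] dexp_def[abs_def]
    by (rule curve_cauchy_product) (auto simp: expterm_order dexpterm_order w0)
  finally show "curve_deriv (curve_exp w a) n = (dexp w \<odot> curve_exp w a + curve_exp w (curve_deriv a)) n"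
    by (simp add: add.commute)
qed

lemma curve_exp_0: "curve_exp w a 0 = a 0"
  by (simp add: curve_exp_def)

lemma curve_exp_zero: "curve_exp w 0 = 0"
proof -
  have "((\<odot>) w ^^ k) 0 = 0" for k
    by (induction k) (simp_all only: funpow.simps o_apply id_apply curve_br_zero_right)
  then show ?thesis by (auto simp: curve_exp_def expterm_def curve_scale_def)
qed

lemma curve_deriv_const: "curve_deriv (const_curve x) = 0"
  by (auto simp: curve_deriv_def const_curve_def fun_eq_iff)

lemma curve_deriv_lin: "curve_deriv (lin_curve x) = const_curve x"
  by (auto simp: curve_deriv_def const_curve_def lin_curve_def fun_eq_iff)

lemma const_curve_br_nth: "(const_curve x \<odot> a) n = br x (a n)"
proof -
  have "(const_curve x \<odot> a) n = (\<Sum>i\<le>n. if i = 0 then br x (a n) else 0)"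
    unfolding curve_br_def by (intro sum.cong) (auto simp: const_curve_def br_simps)
  then show ?thesis by simp
qed

lemma const_curve_br: "const_curve x \<odot> const_curve y = const_curve (br x y)"
  by (rule ext) (simp add: const_curve_br_nth, simp add: const_curve_def br_simps)

lemma lin_curve_br_nth: "(lin_curve x \<odot> a) n = (if n = 0 then 0 else br x (a (n - 1)))"
proof -
  have "(lin_curve x \<odot> a) n = (\<Sum>i\<le>n. if i = 1 then br x (a (n - 1)) else 0)"
    unfolding curve_br_def by (intro sum.cong) (auto simp: lin_curve_def br_simps)
  then show ?thesis by simp
qed

lemma curve_exp_lin_const: "curve_exp (lin_curve y) (const_curve x) n = (1 / fact n) *s (br y ^^ n) x"
proof -
  have "((\<odot>) (lin_curve y) ^^ k) (const_curve x) n = (if n = k then (br y ^^ k) x else 0)" for k n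
    by (induction k arbitrary: n) (auto simp: const_curve_def lin_curve_br_nth br_simps)
  then have "curve_exp (lin_curve y) (const_curve x) n
      = (\<Sum>k\<le>n. if k = n then (1 / fact n) *s (br y ^^ n) x else 0)"
    unfolding curve_exp_def expterm_def curve_scale_def by (intro sum.cong) auto
  then show ?thesis by simp
qed

lemma lin_curve_mem_L: "y \<in> L \<Longrightarrow> lin_curve y i \<in> L"
  by (simp add: lin_curve_def L_mem)

text \<open>Along the line s y all higher terms contain {y,y} = 0, so exp(sy) solves an equation
  with constant coefficient y.\<close>

lemma dexp_lin:
  assumes "y \<in> L"
  shows "dexp (lin_curve y) = const_curve y"
proof
  fix n
  have "lin_curve y \<odot> const_curve y = 0"
    using assms by (auto simp: fun_eq_iff lin_curve_br_nth const_curve_def br_simps br_self)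
  then have "dexpterm (lin_curve y) j = (if j = 0 then const_curve y else 0)" for j
  proof (induction j)
    case (Suc j)
    have "((\<odot>) (lin_curve y) ^^ Suc i) (const_curve y) = 0" for i
      using Suc.prems by (induction i) (simp_all only: funpow.simps o_apply id_apply curve_br_zero_right)
    then show ?case
      by (simp only: dexpterm_def curve_deriv_lin curve.scale_zero_right nat.simps if_False)
  qed (simp add: dexpterm_def curve_deriv_lin)
  then have "dexp (lin_curve y) n = (\<Sum>j\<le>n. if j = 0 then const_curve y n else 0)"
    unfolding dexp_def by (intro sum.cong) auto
  then show "dexp (lin_curve y) n = const_curve y n" by simp
qed

text \<open>In the product rule the inner derivative exp(sy) {z, exp(sz) x} is the bracket of
  exp(sy) z with P, since exp(sy) preserves brackets. The coefficient does not depend on x, so one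
  exponent will serve all x.\<close>

lemma curve_exp_exp_ode:
  assumes y: "y \<in> L" and z: "z \<in> L"
    and P_def: "P = curve_exp (lin_curve y) (curve_exp (lin_curve z) (const_curve x))"
  shows "curve_deriv P = (const_curve y + curve_exp (lin_curve y) (const_curve z)) \<odot> P"
    and "P 0 = x"
proof -
  have lin0: "lin_curve v 0 = 0" for v
    by (simp add: lin_curve_def)
  have "curve_deriv (curve_exp (lin_curve z) (const_curve x))
      = const_curve z \<odot> curve_exp (lin_curve z) (const_curve x)"
    by (simp only: curve_deriv_exp[of "lin_curve z", OF lin_curve_mem_L[OF z] lin0] dexp_lin[OF z]
        curve_deriv_const curve_exp_zero add_0_right)
  then show "curve_deriv P = (const_curve y + curve_exp (lin_curve y) (const_curve z)) \<odot> P"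
    unfolding P_def curve_deriv_exp[of "lin_curve y", OF lin_curve_mem_L[OF y] lin0] dexp_lin[OF y] curve_br_add_left
    by (simp only: curve_exp_br[of "lin_curve y", OF lin_curve_mem_L[OF y] lin0])
  show "P 0 = x"
    by (simp add: P_def curve_exp_0 const_curve_def)
qed

section \<open>Filtration estimates and the logarithm of a product of exponentials\<close>

lemma curve_br_F:
  assumes "\<And>i. a i \<in> F (i + p)" "\<And>i. b i \<in> F (i + q)"
  shows "(a \<odot> b) n \<in> F (n + (p + q))"
  unfolding curve_br_def
proof (rule F_mem)
  fix i assume "i \<in> {..n}"
  then show "br (a i) (b (n - i)) \<in> F (n + (p + q))"
    by (intro br_F_ge[OF assms(1)[of i] assms(2)[of "n - i"]]) auto
qed

lemma curve_br_L: "(\<And>i. a i \<in> L) \<Longrightarrow> (\<And>i. b i \<in> L) \<Longrightarrow> (a \<odot> b) n \<in> L"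
  unfolding curve_br_def by (intro L_mem br_L)

lemma curve_br_F_right: "(\<And>i. b i \<in> F r) \<Longrightarrow> (a \<odot> b) n \<in> F r"
  unfolding curve_br_def by (intro F_mem br_F_ge[of _ 0 _ r]) (auto simp: F_0)

lemma funpow_curve_br_F:
  assumes "\<And>i. w i \<in> F i" "\<And>i. a i \<in> F (i + q)"
  shows "((\<odot>) w ^^ k) a n \<in> F (n + q)"
proof (induction k arbitrary: n)
  case (Suc k)
  then show ?case using curve_br_F[of w 0 "((\<odot>) w ^^ k) a" q n] assms(1) by simp
qed (simp add: assms)

lemma funpow_curve_br_L:
  assumes "\<And>i. w i \<in> L" "\<And>i. a i \<in> L"
  shows "((\<odot>) w ^^ k) a n \<in> L"
  by (induction k arbitrary: n) (auto intro: assms curve_br_L)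

lemma funpow_curve_br_F_right:
  assumes "\<And>i. a i \<in> F r"
  shows "((\<odot>) w ^^ k) a n \<in> F r"
  by (induction k arbitrary: n) (auto intro: assms curve_br_F_right)

lemma funpow_br_F: "y \<in> F 1 \<Longrightarrow> x \<in> F p \<Longrightarrow> (br y ^^ k) x \<in> F (k + p)"
  by (induction k) (auto intro: br_F_ge)

lemma funpow_br_L: "y \<in> L \<Longrightarrow> x \<in> L \<Longrightarrow> (br y ^^ k) x \<in> L"
  by (induction k) (auto intro: br_L)

lemma curve_br_causal:
  assumes "a 0 = 0" "b 0 = 0" "\<And>i. i \<le> m \<Longrightarrow> a i = b i" "\<And>i. i < m \<Longrightarrow> c i = c' i" "i \<le> m"
  shows "(a \<odot> c) i = (b \<odot> c') i"
  unfolding curve_br_def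
proof (rule sum.cong[OF refl])
  fix j assume "j \<in> {..i}"
  then show "br (a j) (c (i - j)) = br (b j) (c' (i - j))"
    using assms by (cases "j = 0") (auto simp: br_simps)
qed

text \<open>\<open>curve_deriv a\<close> at m reads \<open>a (m + 1)\<close>, but for j > 0 a
  bracket with \<open>a\<close>, whose constant coefficient is 0, lowers that index. Hence only the
  term j = 0 of \<open>dexp\<close> contains the new coefficient, and the equation for it is a
  recursion.\<close>

lemma dexpterm_causal:
  assumes "a 0 = 0" "b 0 = 0" "\<And>i. i \<le> m \<Longrightarrow> a i = b i" "0 < j"
  shows "dexpterm a j m = dexpterm b j m"
proof -
  have d: "i < m \<Longrightarrow> curve_deriv a i = curve_deriv b i" for i
    by (simp add: curve_deriv_def assms(3))
  have "i \<le> m \<Longrightarrow> ((\<odot>) a ^^ Suc k) (curve_deriv a) i = ((\<odot>) b ^^ Suc k) (curve_deriv b) i" for i k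
  proof (induction k arbitrary: i)
    case 0
    show ?case unfolding funpow.simps o_def id_def
      by (rule curve_br_causal[of a b m]) (use assms(1-3) 0 d in auto)
  next
    case (Suc k)
    have "((\<odot>) a ^^ Suc k) (curve_deriv a) l = ((\<odot>) b ^^ Suc k) (curve_deriv b) l" if "l < m" for l
      by (rule Suc.IH) (use that Suc.prems in auto)
    then show ?case unfolding funpow.simps(2)[of "Suc k"] o_def
      by (intro curve_br_causal[of a b m] Suc.prems(1) assms(1-3))
  qed
  moreover obtain k where "j = Suc k" using assms(4) by (cases j) auto
  ultimately show ?thesis by (simp only: dexpterm_def curve_scale_def)
qed

text \<open>Coefficient m of the equation is solved for \<open>w (m + 1)\<close> by dividing by m +
  1. Modulo F_(n+1) the solution is s (y + z): a bracket containing y and another factor from F_1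
  disappears, and y + z brackets with itself to zero.\<close>

lemma dexp_surj:
  assumes n: "1 \<le> n" and y: "y \<in> L" "y \<in> F n" and z: "z \<in> L" "z \<in> F 1"
  obtains w where "dexp w = const_curve y + curve_exp (lin_curve y) (const_curve z)"
    and "\<And>i. w i \<in> L" "\<And>i. w i \<in> F i" "w 0 = 0" "w 1 - (y + z) \<in> F (Suc n)"
    and "\<And>i. 2 \<le> i \<Longrightarrow> w i \<in> F (Suc n)"
proof -
  define u where "u = const_curve y + curve_exp (lin_curve y) (const_curve z)"
  \<comment> \<open>The last two conditions say that the curve is s (y + z) modulo F_(n+1). Building
    them into the fixed point yields the estimate together with existence.\<close>
  define S where "S i = {a \<in> L \<inter> F i. (i = 0 \<longrightarrow> a = 0) \<and> (i = 1 \<longrightarrow> a - (y + z) \<in> F (Suc n)) \<and>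
      (2 \<le> i \<longrightarrow> a \<in> F (Suc n))}" for i
  define T where "T a i = (case i of 0 \<Rightarrow> 0 |
      Suc m \<Rightarrow> (1 / of_nat (Suc m)) *s (u m - (\<Sum>j=1..m. dexpterm a j m)))" for a i
  have y1: "y \<in> F 1" using y(2) n F_mono by blast
  have u0: "u 0 = y + z"
    by (simp add: u_def const_curve_def curve_exp_0)
  have u_eq: "u m = (1 / fact m) *s (br y ^^ m) z" if "m \<noteq> 0" for m
    using that by (simp add: u_def const_curve_def curve_exp_lin_const)
  have u_L: "u m \<in> L" for m
    using u0 u_eq by (cases "m = 0") (auto intro!: L_mem y z funpow_br_L)
  have u_F: "u m \<in> F (Suc m)" for m
    using u0 u_eq funpow_br_F[OF y1 z(2)]
    by (cases "m = 0") (auto intro!: F_add F_scale y1[simplified] z[simplified])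
  have u_Fn: "u m \<in> F (Suc n)" if "m \<noteq> 0" for m
  proof -
    obtain l where "m = Suc l" using \<open>m \<noteq> 0\<close> by (cases m) auto
    then show ?thesis unfolding u_eq[OF that]
      using funpow_br_F[OF y1 z(2), of l] y(2)
      by (auto intro!: F_mem intro: br_F_ge)
  qed
  have d: "lin_curve (y + z) i \<in> S i" for i
    using y z y1 by (auto simp: S_def lin_curve_def intro!: L_mem F_mem)
  have term_L: "dexpterm a j m \<in> L" and term_F: "dexpterm a j m \<in> F (Suc m)"
    and term_Fn: "0 < j \<Longrightarrow> dexpterm a j m \<in> F (Suc n)"
    if a: "\<And>i. a i \<in> S i" for a j m
  proof -
    have aL: "a i \<in> L" and aF: "a i \<in> F i" and a0: "a 0 = 0" and a1: "a 1 - (y + z) \<in> F (Suc n)"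
      and a2: "2 \<le> i \<Longrightarrow> a i \<in> F (Suc n)" for i
      using a unfolding S_def by blast+
    have dL: "curve_deriv a i \<in> L" and dF: "curve_deriv a i \<in> F (i + 1)" for i
      unfolding curve_deriv_def Suc_eq_plus1 by (intro L_mem F_mem aL aF)+
    show "dexpterm a j m \<in> L"
      unfolding dexpterm_def curve_scale_def by (intro L_mem funpow_curve_br_L aL dL)
    show "dexpterm a j m \<in> F (Suc m)"
      using funpow_curve_br_F[of a, OF aF dF]
      unfolding dexpterm_def curve_scale_def Suc_eq_plus1 by (intro F_mem)
    assume "0 < j"
    then obtain k where k: "j = Suc k" by (cases j) auto
    have "(a \<odot> curve_deriv a) i \<in> F (Suc n)" for i
      unfolding curve_br_def
    proof (intro F_mem)
      fix l assume "l \<in> {..i}"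
      \<comment> \<open>\<open>a 0\<close> vanishes and coefficients of index at least 2 lie in
        F_(n+1). The one remaining pair is {\<open>a 1\<close>, \<open>a 1\<close>}, which is zero
        because \<open>a 1\<close> lies in \<open>L\<close>.\<close>
      consider "l = 0" | "2 \<le> l" | "l = 1" "i - l \<noteq> 0" | "l = 1" "i - l = 0"
        by (cases "l = 0"; cases "l = 1") (auto simp: numeral_2_eq_2)
      then show "br (a l) (curve_deriv a (i - l)) \<in> F (Suc n)"
      proof cases
        case 1
        then show ?thesis by (simp add: a0 br_simps F_mem)
      next
        case 2
        then show ?thesis
          by (intro br_F_ge[OF a2, where q = 0]) (auto simp: F_0)
      next
        case 3
        then have "curve_deriv a (i - l) \<in> F (Suc n)"
          unfolding curve_deriv_def by (intro F_mem a2) auto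
        then show ?thesis by (intro br_F_ge[of _ 0 _ "Suc n"]) (auto simp: F_0)
      next
        case 4
        then show ?thesis by (simp add: curve_deriv_def br_self aL F_mem del: One_nat_def)
            (simp add: br_self aL F_mem)
      qed
    qed
    \<comment> \<open>The innermost bracket \<open>a \<odot> curve_deriv a\<close> already lies in
      F_(n+1), and further brackets keep it there.\<close>
    then show "dexpterm a j m \<in> F (Suc n)"
      unfolding dexpterm_def curve_scale_def k funpow_Suc_right o_def
      by (intro F_mem funpow_curve_br_F_right)
  qed
  have T_S: "T a i \<in> S i" if a: "\<And>i. a i \<in> S i" for a i
  proof (cases i)
    case 0
    then show ?thesis by (simp add: T_def S_def F_mem L_mem)
  next
    case (Suc m)
    have "T a i \<in> L"
      unfolding T_def Suc nat.case by (intro L_mem u_L term_L a)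
    moreover have "T a i \<in> F i"
      unfolding T_def Suc nat.case by (intro F_mem u_F term_F a)
    moreover have "T a i \<in> F (Suc n)" if "m \<noteq> 0"
      unfolding T_def Suc nat.case using that by (intro F_mem u_Fn term_Fn a) auto
    moreover have "T a i - (y + z) \<in> F (Suc n)" if "m = 0"
      using that by (simp add: T_def Suc u0 F_mem)
    ultimately show ?thesis unfolding S_def using Suc by auto
  qed
  have causal: "T a i = T b i" if a: "\<And>i. a i \<in> S i" and b: "\<And>i. b i \<in> S i"
    and eq: "\<And>j. j < i \<Longrightarrow> a j = b j" for a b i
  proof (cases i)
    case (Suc m)
    have "a 0 = 0" "b 0 = 0" using a[of 0] b[of 0] unfolding S_def by auto
    then have "dexpterm a j m = dexpterm b j m" if "0 < j" for j
      using that eq Suc by (intro dexpterm_causal) auto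
    then show ?thesis unfolding T_def Suc by simp
  qed (simp add: T_def)
  obtain w where w: "\<And>i. w i \<in> S i" "T w = w"
    by (rule causal_fixpoint[of "lin_curve (y + z)" S T]) (use d T_S causal in blast)+
  have "dexp w m = u m" for m
  proof -
    have "dexp w m = curve_deriv w m + (\<Sum>j=1..m. dexpterm w j m)"
      unfolding dexp_def
      by (simp add: atMost_atLeast0 sum.atLeast_Suc_atMost dexpterm_def)
    also have "curve_deriv w m = of_nat (Suc m) *s T w (Suc m)"
      by (simp add: curve_deriv_def w)
    finally show ?thesis by (simp add: T_def del: of_nat_Suc)
  qed
  then have "dexp w = u" ..
  then show ?thesis
    using that w(1) unfolding u_def S_def by simp
qed

section \<open>From formal series to their values at s = 1\<close>

lemma ev_const: "ev (const_curve x) = x"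
proof (rule ev_eqI)
  fix n
  show "x - (\<Sum>i<n. const_curve x i) \<in> F n"
    by (cases "n = 0") (auto simp: F_0 const_curve_def sum.delta F_mem)
qed

lemma ev_lin: "y \<in> F 1 \<Longrightarrow> ev (lin_curve y) = y"
proof (rule ev_eqI)
  fix n assume "y \<in> F 1"
  then show "y - (\<Sum>i<n. lin_curve y i) \<in> F n"
    by (cases "n = 0"; cases "n = 1") (auto simp: F_0 lin_curve_def sum.delta F_mem)
qed

lemma ev_scale:
  assumes "\<And>i. a i \<in> F i"
  shows "ev (curve_scale c a) = c *s ev a"
  by (rule ev_eqI)
    (simp add: curve_scale_def F_mem ev_approx assms flip: scale_sum_right scale_right_diff_distrib)

text \<open>The bracket of partial sums runs over the square i, j < n, the convolution over the
  triangle i + j < n. Pairs in between have i + j \<ge> n, so their brackets lie in F_n.\<close>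

lemma ev_br:
  assumes a: "\<And>i. a i \<in> F i" and b: "\<And>i. b i \<in> F i"
  shows "ev (a \<odot> b) = br (ev a) (ev b)"
proof (rule ev_eqI)
  fix n
  let ?A = "\<Sum>i<n. a i" and ?B = "\<Sum>i<n. b i"
  have "br (ev a - ?A) (ev b) \<in> F n" "br ?A (ev b - ?B) \<in> F n"
    using ev_approx[of a n] ev_approx[of b n] a b
    by (auto intro: br_F_ge[where q = 0] br_F_ge[where p = 0] simp: F_0)
  then have 1: "br (ev a - ?A) (ev b) + br ?A (ev b - ?B) \<in> F n"
    by (rule F_add)
  let ?Q = "{..<n} \<times> {..<n}" and ?D = "{(i, j). i + j < n}"
  have D: "?D \<subseteq> ?Q" by auto
  have "br ?A ?B = (\<Sum>i<n. \<Sum>j<n. br (a i) (b j))"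
    unfolding br_simps by (rule sum.swap)
  then have "br ?A ?B = (\<Sum>(i, j)\<in>?Q. br (a i) (b j))"
    by (simp only: sum.cartesian_product)
  moreover have "(\<Sum>k<n. (a \<odot> b) k) = (\<Sum>(i, j)\<in>?D. br (a i) (b j))"
    unfolding curve_br_def sum.triangle_reindex ..
  ultimately have "br ?A ?B - (\<Sum>k<n. (a \<odot> b) k) = (\<Sum>(i, j)\<in>?Q - ?D. br (a i) (b j))"
    using D by (simp add: sum_diff)
  also have "\<dots> \<in> F n"
    by (rule F_mem) (auto intro: br_F_ge[OF a b])
  finally have "br ?A ?B - (\<Sum>k<n. (a \<odot> b) k) \<in> F n" .
  from F_add[OF 1 this] show "br (ev a) (ev b) - (\<Sum>k<n. (a \<odot> b) k) \<in> F n"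
    by (simp add: br_simps)
qed

lemma ev_funpow:
  assumes w: "\<And>i. w i \<in> F i" and a: "\<And>i. a i \<in> F i"
  shows "ev (((\<odot>) w ^^ k) a) = (br (ev w) ^^ k) (ev a)"
  using funpow_curve_br_F[of w a 0] assms
  by (induction k) (simp_all add: ev_br)

definition lexp :: "'v \<Rightarrow> 'v \<Rightarrow> 'v" where
  "lexp y x = ev (\<lambda>k. (1 / fact k) *s (br y ^^ k) x)"

lemma lexp_term_F: "y \<in> F 1 \<Longrightarrow> (1 / fact k) *s (br y ^^ k) x \<in> F k"
  using funpow_br_F[of y x 0 k] by (auto simp: F_0 intro: F_mem)

lemma lexp_approx_sum: "y \<in> F 1 \<Longrightarrow> lexp y x - (\<Sum>k<n. (1 / fact k) *s (br y ^^ k) x) \<in> F n"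
  unfolding lexp_def by (intro ev_approx lexp_term_F)

lemma curve_exp_F:
  assumes "\<And>i. w i \<in> F i" "\<And>i. a i \<in> F i"
  shows "curve_exp w a n \<in> F n"
  using funpow_curve_br_F[of w a 0] assms
  unfolding curve_exp_def expterm_def curve_scale_def by (intro F_mem) simp

text \<open>The formal exponential is summed by powers of s, \<open>lexp\<close> by powers of the
  bracket. Modulo F_p only n, k < p matter in the double series, and that finite sum can be
  exchanged.\<close>

lemma ev_curve_exp:
  assumes w: "\<And>i. w i \<in> F i" "w 0 = 0" and a: "\<And>i. a i \<in> F i"
  shows "ev (curve_exp w a) = lexp (ev w) (ev a)"
proof (rule eq_if_diff_F)
  fix p
  have w1: "ev w \<in> F 1"
    using ev_approx[of w 1] w by simp
  have termF: "expterm w k a n \<in> F n" for k n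
    using funpow_curve_br_F[of w a 0] w a
    unfolding expterm_def curve_scale_def by (intro F_mem) simp
  have "(\<Sum>n<p. curve_exp w a n) = (\<Sum>n<p. \<Sum>k<p. expterm w k a n)"
    unfolding curve_exp_def
    by (intro sum.cong refl sum.mono_neutral_left) (auto simp: expterm_order w)
  also have "\<dots> = (\<Sum>k<p. \<Sum>n<p. expterm w k a n)"
    by (rule sum.swap)
  finally have 1: "ev (curve_exp w a) - (\<Sum>k<p. \<Sum>n<p. expterm w k a n) \<in> F p"
    using ev_approx[of "curve_exp w a" p] curve_exp_F[of w a] w a by simp
  have "(\<Sum>k<p. ev (expterm w k a) - (\<Sum>n<p. expterm w k a n)) \<in> F p"
    by (intro F_mem ev_approx termF)
  moreover have "ev (expterm w k a) = (1 / fact k) *s (br (ev w) ^^ k) (ev a)" for k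
    using funpow_curve_br_F[of w a 0] w a by (simp add: expterm_def ev_scale ev_funpow)
  ultimately have 2: "(\<Sum>k<p. (1 / fact k) *s (br (ev w) ^^ k) (ev a))
      - (\<Sum>k<p. \<Sum>n<p. expterm w k a n) \<in> F p"
    by (simp add: sum_subtractf)
  from F_diff[OF F_diff[OF 1 2] lexp_approx_sum[OF w1, of "ev a" p]]
  show "ev (curve_exp w a) - lexp (ev w) (ev a) \<in> F p" by simp
qed

lemma const_curve_F: "const_curve x i \<in> F i"
  by (cases i) (auto simp: const_curve_def F_0 F_mem)

lemma lin_curve_F: "y \<in> F 1 \<Longrightarrow> lin_curve y i \<in> F i"
  by (auto simp: lin_curve_def F_mem)

lemma lin_curve_0: "lin_curve y 0 = 0"
  by (simp add: lin_curve_def)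

lemma ev_curve_exp_lin:
  "y \<in> F 1 \<Longrightarrow> (\<And>i. a i \<in> F i) \<Longrightarrow> ev (curve_exp (lin_curve y) a) = lexp y (ev a)"
  by (simp add: ev_curve_exp lin_curve_F lin_curve_0 ev_lin)

lemma lexp_lexp:
  assumes "y \<in> F 1" "z \<in> F 1"
  shows "lexp y (lexp z x) = ev (curve_exp (lin_curve y) (curve_exp (lin_curve z) (const_curve x)))"
  using assms by (simp add: ev_curve_exp_lin curve_exp_F lin_curve_F const_curve_F ev_const)

lemma lexp_br:
  assumes "y \<in> L" "y \<in> F 1"
  shows "lexp y (br a b) = br (lexp y a) (lexp y b)"
proof -
  have exp_const: "ev (curve_exp (lin_curve y) (const_curve x)) = lexp y x" for x
    using assms by (simp add: ev_curve_exp_lin const_curve_F ev_const)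
  have "lexp y (br a b) = ev (curve_exp (lin_curve y) (const_curve a \<odot> const_curve b))"
    by (simp add: const_curve_br exp_const)
  also have "\<dots> = br (lexp y a) (lexp y b)"
    using assms by (simp add: curve_exp_br lin_curve_mem_L lin_curve_0 ev_br curve_exp_F
        lin_curve_F const_curve_F exp_const)
  finally show ?thesis .
qed

lemma lexp_zero: "lexp y 0 = 0"
proof -
  have "(br y ^^ k) 0 = 0" for k
    by (induction k) (auto simp: br_simps)
  then show ?thesis
    unfolding lexp_def by (intro ev_eqI) (simp add: F_mem)
qed

lemma lexp_inverse:
  assumes y: "y \<in> L" "y \<in> F 1"
  shows "lexp y (lexp (- y) x) = x"
proof -
  define P where "P = curve_exp (lin_curve y) (curve_exp (lin_curve (- y)) (const_curve x))"
  have my: "- y \<in> L" "- y \<in> F 1" using y by (auto intro: L_mem F_mem)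
  \<comment> \<open>exp(sy) fixes -y, so the differential equation of the product has coefficient 0
    and the product is constant in s.\<close>
  have "(br y ^^ k) (- y) = (if k = 0 then - y else 0)" for k
    by (induction k) (auto simp: br_simps br_self y)
  then have "const_curve y + curve_exp (lin_curve y) (const_curve (- y)) = 0"
    by (auto simp: fun_eq_iff curve_exp_lin_const const_curve_def)
  then have P: "curve_deriv P = 0 \<odot> P" "P 0 = x"
    using curve_exp_exp_ode[OF y(1) my(1) P_def] by simp_all
  have "P = const_curve x"
  proof (rule curve_ode_unique[OF P(1)])
    show "curve_deriv (const_curve x) = 0 \<odot> const_curve x"
      by (simp only: curve_deriv_const curve_br_zero_left)
    show "P 0 = const_curve x 0"
      by (simp add: P(2) const_curve_def)
  qed
  then show ?thesis
    unfolding lexp_lexp[OF y(2) my(2)] P_def by (simp add: ev_const)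
qed

text \<open>The exponent is the value at s = 1 of the formal logarithm from
  \<open>dexp_surj\<close>; both sides solve the same linear equation with the same initial value.
  The estimate with z merely in F_1 is what lets iterated composites converge.\<close>

theorem baker_campbell_hausdorff:
  assumes n: "1 \<le> n" and y: "y \<in> L" "y \<in> F n" and z: "z \<in> L" "z \<in> F 1"
  obtains w where "w \<in> L" "w \<in> F 1" "w - (y + z) \<in> F (Suc n)"
    and "\<And>x. lexp w x = lexp y (lexp z x)"
proof -
  obtain w where w: "dexp w = const_curve y + curve_exp (lin_curve y) (const_curve z)"
    "\<And>i. w i \<in> L" "\<And>i. w i \<in> F i" "w 0 = 0" "w 1 - (y + z) \<in> F (Suc n)"
    "\<And>i. 2 \<le> i \<Longrightarrow> w i \<in> F (Suc n)"
    using dexp_surj[OF assms] by blast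
  have y1: "y \<in> F 1" using y(2) n F_mono by blast
  show ?thesis
  proof
    show "ev w \<in> L"
      by (rule ev_in_subspace[OF L_subspace L_closed]) (use w in auto)
    show "ev w \<in> F 1"
      using ev_approx[of w 1] w by simp
    have "{..<Suc n} = insert 0 (insert 1 {2..<Suc n})"
      using n by auto
    then have "(\<Sum>i<Suc n. w i) = w 0 + (w 1 + (\<Sum>i\<in>{2..<Suc n}. w i))"
      by simp
    moreover have "ev w - (\<Sum>i<Suc n. w i) \<in> F (Suc n)"
      by (intro ev_approx w)
    moreover have "(\<Sum>i\<in>{2..<Suc n}. w i) \<in> F (Suc n)"
      by (intro F_mem w) auto
    ultimately have "(ev w - (w 1 + (\<Sum>i\<in>{2..<Suc n}. w i))) + (\<Sum>i\<in>{2..<Suc n}. w i)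
        + (w 1 - (y + z)) \<in> F (Suc n)"
      by (intro F_add w) (simp_all add: w)
    then show "ev w - (y + z) \<in> F (Suc n)" by (simp add: algebra_simps)
    fix x
    have "curve_exp w (const_curve x)
       = curve_exp (lin_curve y) (curve_exp (lin_curve z) (const_curve x))"
      (is "?l = ?r")
    proof (rule curve_ode_unique)
      show "curve_deriv ?l = dexp w \<odot> ?l"
        by (simp only: curve_deriv_exp[of w, OF w(2,4)] curve_deriv_const curve_exp_zero add_0_right)
      show "curve_deriv ?r = dexp w \<odot> ?r" "?l 0 = ?r 0"
        using curve_exp_exp_ode[OF y(1) z(1) refl, of x] w(1)
        by (simp_all add: curve_exp_0 const_curve_def)
    qed
    then show "lexp (ev w) x = lexp y (lexp z x)"
      unfolding lexp_lexp[OF y1 z(2)]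
      using ev_curve_exp[of w "const_curve x"] w by (simp add: ev_const const_curve_F)
  qed
qed

text \<open>A term with k \<ge> 2 is a bracket of y, which lies in F_n, with an element of F_1,
  since that element again contains y.\<close>

lemma lexp_linear_approx:
  assumes n: "1 \<le> n" and y: "y \<in> F n"
  shows "lexp y x - (x + br y x) \<in> F (Suc n)"
proof -
  let ?t = "\<lambda>k. (1 / fact k) *s (br y ^^ k) x"
  have y1: "y \<in> F 1" using assms F_mono by blast
  have "?t k \<in> F (Suc n)" if k: "k \<in> {2..<Suc (Suc n)}" for k
  proof -
    obtain l where l: "k = Suc (Suc l)"
      using k by (cases k; cases "k - 1") auto
    have "(br y ^^ Suc l) x \<in> F (Suc l)"
      using funpow_br_F[OF y1, of x 0 "Suc l"] by (simp add: F_0)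
    then show ?thesis
      unfolding l funpow.simps(2)[of "Suc l"] o_def by (intro F_mem br_F_ge[OF y]) auto
  qed
  then have "(\<Sum>k\<in>{2..<Suc (Suc n)}. ?t k) \<in> F (Suc n)"
    by (rule F_sum)
  moreover have "lexp y x - (\<Sum>k<Suc (Suc n). ?t k) \<in> F (Suc n)"
    using lexp_approx_sum[OF y1, of x "Suc (Suc n)"] F_Suc by blast
  ultimately have "(lexp y x - (\<Sum>k<Suc (Suc n). ?t k)) + (\<Sum>k\<in>{2..<Suc (Suc n)}. ?t k) \<in> F (Suc n)"
    by (intro F_add)
  moreover have "(\<Sum>k<Suc (Suc n). ?t k) = x + (br y x + (\<Sum>k\<in>{2..<Suc (Suc n)}. ?t k))"
    unfolding lessThan_atLeast0 by (simp add: sum.atLeast_Suc_lessThan numeral_2_eq_2 del: sum.op_ivl_Suc)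
  ultimately show ?thesis by (simp add: algebra_simps)
qed

lemma lexp_continuous:
  assumes y: "y \<in> F 1" and y': "y' \<in> F 1" and d: "y - y' \<in> F n"
  shows "lexp y x - lexp y' x \<in> F n"
proof -
  have "(br y ^^ k) x - (br y' ^^ k) x \<in> F n" for k
  proof (induction k)
    case (Suc k)
    \<comment> \<open>Telescoping: the outer factor y is exchanged for y' first, the inner ones by
      induction.\<close>
    have "br (y - y') ((br y ^^ k) x) + br y' ((br y ^^ k) x - (br y' ^^ k) x) \<in> F n"
      using d Suc by (intro F_add) (auto intro: br_F_ge[where q = 0] br_F_ge[where p = 0] simp: F_0)
    then show ?case by (simp add: br_simps)
  qed (simp add: F_mem)
  then have "(\<Sum>k<n. (1 / fact k) *s ((br y ^^ k) x - (br y' ^^ k) x)) \<in> F n"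
    by (intro F_sum F_scale)
  from F_diff[OF F_add[OF lexp_approx_sum[OF y, of x n] this] lexp_approx_sum[OF y', of x n]]
  show ?thesis by (simp add: scale_right_diff_distrib sum_subtractf)
qed

end

section \<open>The gauge action\<close>

lemma (in vector_space) linear_selfI:
  assumes "\<And>x y. f (x + y) = f x + f y" "\<And>c x. f (scale c x) = scale c (f x)"
  shows "Vector_Spaces.linear scale scale f"
  by unfold_locales (fact assms)+

context odd_dgla
begin

lemmas dif_hom = dif_linear[folded module_hom_eq_linear]
  and brk_hom_left = brk_linear_left[folded module_hom_eq_linear]
  and brk_hom_right = brk_linear_right[folded module_hom_eq_linear]

lemmas dif_simps = module_hom.add[OF dif_hom] module_hom.diff[OF dif_hom] module_hom.neg[OF dif_hom]
  module_hom.scale[OF dif_hom] module_hom.zero[OF dif_hom] module_hom.sum[OF dif_hom]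

lemmas brk_simps =
  module_hom.add[OF brk_hom_left] module_hom.diff[OF brk_hom_left] module_hom.neg[OF brk_hom_left]
  module_hom.scale[OF brk_hom_left] module_hom.zero[OF brk_hom_left] module_hom.sum[OF brk_hom_left]
  module_hom.add[OF brk_hom_right] module_hom.diff[OF brk_hom_right] module_hom.neg[OF brk_hom_right]
  module_hom.scale[OF brk_hom_right] module_hom.zero[OF brk_hom_right] module_hom.sum[OF brk_hom_right]

lemmas gr_mem = subspace_0[OF gr_subspace] subspace_add[OF gr_subspace] subspace_diff[OF gr_subspace]
  subspace_neg[OF gr_subspace] subspace_scale[OF gr_subspace] subspace_sum[OF gr_subspace]

lemma gr_decompose:
  obtains a0 a1 where "a0 \<in> gr A 0" "a1 \<in> gr A 1" "a = a0 + a1"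
proof -
  have "a \<in> gr A 0 + gr A 1" by (simp add: gr_sum)
  then show ?thesis using that unfolding set_plus_def by blast
qed

lemma brk_even_sym:
  assumes "x \<in> gr A 0"
  shows "brk A x b = brk A b x"
proof -
  obtain b0 b1 where b: "b0 \<in> gr A 0" "b1 \<in> gr A 1" "b = b0 + b1" by (rule gr_decompose)
  show ?thesis
    using brk_sym[OF assms b(1)] brk_sym[OF assms b(2)] by (simp add: b(3) brk_simps ksign_def)
qed

lemma eq_uminus_imp_zero:
  assumes "a = - a"
  shows "a = (0::'a)"
proof -
  have "scl A 2 a = scl A 1 a + scl A 1 a"
    unfolding scale_left_distrib[symmetric] by simp
  also have "\<dots> = 0" using assms by (metis add.right_inverse scale_one)
  finally show ?thesis by simp
qed

lemma brk_odd_self: "y \<in> gr A 1 \<Longrightarrow> brk A y y = 0"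
  using brk_sym[of y 1 y 1] by (intro eq_uminus_imp_zero) (simp add: ksign_def)

text \<open>For an odd first argument both signs in the Jacobi identity are plus, so {y,-} is an
  ordinary derivation. Only odd elements are exponentiated.\<close>

lemma jacobi_odd:
  assumes "y \<in> gr A 1"
  shows "brk A y (brk A a b) = brk A (brk A y a) b + brk A a (brk A y b)"
proof -
  obtain a0 a1 where a: "a0 \<in> gr A 0" "a1 \<in> gr A 1" "a = a0 + a1" by (rule gr_decompose)
  show ?thesis
    using jacobi[OF assms a(1), of b] jacobi[OF assms a(2), of b]
    by (simp add: a(3) brk_simps ksign_def algebra_simps)
qed

lemma dif_brk_odd: "y \<in> gr A 1 \<Longrightarrow> dif A (brk A y b) = brk A y (dif A b) - brk A (dif A y) b"
  using dif_brk[of y 1 b] by (simp add: ksign_def)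

lemma dif_even: "y \<in> gr A 1 \<Longrightarrow> dif A y \<in> gr A 0"
  using dif_odd[of y 1] by simp

lemma brk_odd_even: "y \<in> gr A 1 \<Longrightarrow> x \<in> gr A 0 \<Longrightarrow> brk A y x \<in> gr A 0"
  using brk_odd[of y 1 x 0] by simp

lemma brk_odd_odd: "y \<in> gr A 1 \<Longrightarrow> x \<in> gr A 1 \<Longrightarrow> brk A y x \<in> gr A 1"
  using brk_odd[of y 1 x 1] by simp

end

context strongly_filtered_dgla
begin

lemmas fil_zero = subspace_0[OF fil_subspace]
  and fil_add = subspace_add[OF fil_subspace]
  and fil_diff = subspace_diff[OF fil_subspace]
  and fil_neg = subspace_neg[OF fil_subspace]
  and fil_scale = subspace_scale[OF fil_subspace]

lemma fil_mono: "a \<in> fil A q \<Longrightarrow> p \<le> q \<Longrightarrow> a \<in> fil A p"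
  using lift_Suc_antimono_le[of "fil A" p q] fil_decreasing by blast

lemma fil_brk_ge: "a \<in> fil A p \<Longrightarrow> b \<in> fil A q \<Longrightarrow> r \<le> p + q \<Longrightarrow> brk A a b \<in> fil A r"
  using fil_brk fil_mono by blast

lemma fil_brk_left: "a \<in> fil A p \<Longrightarrow> brk A a b \<in> fil A p"
  and fil_brk_right: "b \<in> fil A p \<Longrightarrow> brk A a b \<in> fil A p"
  by (rule fil_brk_ge[where p = p and q = 0] fil_brk_ge[where p = 0 and q = p]; simp add: fil_0)+

lemma fil_dif_Suc: "a \<in> fil A p \<Longrightarrow> dif A a \<in> fil A (Suc p)"
  using fil_dif by simp

lemma zero_if_fil: "(\<And>p. a \<in> fil A p) \<Longrightarrow> a = 0"
  using fil_hausdorff by (metis INT_I singletonD)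

text \<open>The component of l of the other parity lies in every F_p, because the F_p are graded,
  and so vanishes.\<close>

lemma gr_closed:
  assumes s: "\<And>n. s n \<in> gr A i" and l: "fil_converges (fil A) s l"
  shows "l \<in> gr A i"
proof -
  obtain l0 l1 where l01: "l0 \<in> gr A 0" "l1 \<in> gr A 1" "l = l0 + l1" by (rule gr_decompose)
  have ex: "\<exists>n. s n - l \<in> fil A p" for p
    using l unfolding fil_converges_def by blast
  have "if i = 0 then l1 \<in> fil A p else l0 \<in> fil A p" for p
  proof -
    obtain n where n: "s n - l \<in> fil A p" using ex by blast
    show ?thesis
    proof (cases "i = 0")
      case True
      then have "(s n - l0) + (- l1) \<in> fil A p" "s n - l0 \<in> gr A 0" "- l1 \<in> gr A 1"
        using n l01 s[of n] by (auto simp: algebra_simps intro: gr_mem)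
      then have "- l1 \<in> fil A p" using fil_graded by blast
      then show ?thesis using True fil_neg by fastforce
    next
      case False
      then have "(- l0) + (s n - l1) \<in> fil A p" "s n - l1 \<in> gr A 1" "- l0 \<in> gr A 0"
        using n l01 s[of n] by (auto simp: algebra_simps intro: gr_mem)
      then have "- l0 \<in> fil A p" using fil_graded by blast
      then show ?thesis using False fil_neg by fastforce
    qed
  qed
  then show ?thesis
    using l01 zero_if_fil[of l0] zero_if_fil[of l1] by (cases "i = 0") auto
qed

text \<open>Adjoin to \<open>g\<close> an even element \<open>\<delta>\<close> with \<open>{\<delta>,\<delta>} = 0\<close> and \<open>{\<delta>,x} = dx\<close>. The pair \<open>(c, x)\<close>
  stands for \<open>c\<delta> + x\<close>; then \<open>x\<close> is a Maurer-Cartan element iff \<open>{\<delta> + x, \<delta> + x} = 0\<close>, and the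
  affine gauge action on \<open>x\<close> is the linear action of \<open>exp {y,-}\<close> on \<open>\<delta> + x\<close>.\<close>

definition hat_scale :: "'k \<Rightarrow> 'k \<times> 'a \<Rightarrow> 'k \<times> 'a" where
  "hat_scale c X = (c * fst X, scl A c (snd X))"

definition hat_brk :: "'k \<times> 'a \<Rightarrow> 'k \<times> 'a \<Rightarrow> 'k \<times> 'a" where
  "hat_brk X Y = (0, brk A (snd X) (snd Y) + scl A (fst X) (dif A (snd Y)) + scl A (fst Y) (dif A (snd X)))"

text \<open>\<delta> has filtration degree 0 only: a Cauchy sequence has an eventually constant
  \<delta>-coefficient, and bracketing with \<delta> respects degrees because d preserves each
  F_p.\<close>

definition hat_fil :: "nat \<Rightarrow> ('k \<times> 'a) set" where
  "hat_fil p = (if p = 0 then UNIV else {0} \<times> fil A p)"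

definition hat_odd :: "('k \<times> 'a) set" where
  "hat_odd = {0} \<times> gr A 1"

lemma hat_fil_snd: "X \<in> hat_fil p \<Longrightarrow> snd X \<in> fil A p"
  by (auto simp: hat_fil_def fil_0 split: if_splits)

lemma hat_fil_fst: "X \<in> hat_fil p \<Longrightarrow> p \<noteq> 0 \<Longrightarrow> fst X = 0"
  by (auto simp: hat_fil_def split: if_splits)

lemma hat_filI: "x \<in> fil A p \<Longrightarrow> (0, x) \<in> hat_fil p"
  by (auto simp: hat_fil_def)

lemma hat_vector_space: "vector_space hat_scale"
  by standard (auto simp: hat_scale_def algebra_simps)

interpretation hat_vs: vector_space hat_scale
  by (rule hat_vector_space)

lemma hat_fil_complete:
  assumes "fil_cauchy hat_fil s"
  shows "\<exists>l. fil_converges hat_fil s l"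
proof -
  have "fil_cauchy (fil A) (\<lambda>n. snd (s n))"
    using assms hat_fil_snd unfolding fil_cauchy_def by (metis snd_diff)
  then obtain l where l: "fil_converges (fil A) (\<lambda>n. snd (s n)) l" using fil_complete by blast
  obtain N where N: "\<And>m n. m \<ge> N \<Longrightarrow> n \<ge> N \<Longrightarrow> s m - s n \<in> hat_fil 1"
    using assms unfolding fil_cauchy_def by metis
  have "fil_converges hat_fil s (fst (s N), l)"
    unfolding fil_converges_def
  proof
    fix p
    obtain M where M: "\<And>n. n \<ge> M \<Longrightarrow> snd (s n) - l \<in> fil A p"
      using l unfolding fil_converges_def by metis
    have "s n - (fst (s N), l) \<in> hat_fil p" if "n \<ge> max M N" for n
    proof -
      have "s n - (fst (s N), l) = (0, snd (s n) - l)"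
        using hat_fil_fst[OF N[of n N]] that by (simp add: prod_eq_iff)
      then show ?thesis using hat_filI[OF M] that by simp
    qed
    then show "\<exists>K. \<forall>n\<ge>K. s n - (fst (s N), l) \<in> hat_fil p"
      by (intro exI[of _ "max M N"] allI impI)
  qed
  then show ?thesis by blast
qed

lemma hat_complete_leibniz: "complete_leibniz hat_scale hat_brk hat_fil hat_odd"
proof (intro complete_leibniz.intro complete_leibniz_axioms.intro hat_vector_space)
  show "Vector_Spaces.linear hat_scale hat_scale (\<lambda>a. hat_brk a b)" for b
    by (rule hat_vs.linear_selfI)
      (simp_all add: hat_brk_def hat_scale_def brk_simps dif_simps algebra_simps)
  show "Vector_Spaces.linear hat_scale hat_scale (hat_brk a)" for a
    by (rule hat_vs.linear_selfI)
      (simp_all add: hat_brk_def hat_scale_def brk_simps dif_simps algebra_simps)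
  show "hat_vs.subspace (hat_fil p)" for p
    by (rule hat_vs.subspaceI)
      (auto simp: hat_fil_def hat_scale_def zero_prod_def fil_zero fil_add fil_scale)
  show "hat_fil 0 = UNIV"
    by (simp add: hat_fil_def)
  show "hat_fil (Suc p) \<subseteq> hat_fil p" for p
    using fil_decreasing by (auto simp: hat_fil_def)
  show "(\<Inter>p. hat_fil p) = {0}"
  proof
    show "(\<Inter>p. hat_fil p) \<subseteq> {0}"
    proof
      fix X assume X: "X \<in> (\<Inter>p. hat_fil p)"
      then have "X \<in> hat_fil 1" by blast
      then have "fst X = 0" by (rule hat_fil_fst) simp
      moreover have "snd X = 0"
        using X hat_fil_snd by (intro zero_if_fil) blast
      ultimately show "X \<in> {0}" by (simp add: prod_eq_iff)
    qed
    show "{0} \<subseteq> (\<Inter>p. hat_fil p)"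
      by (auto simp: hat_fil_def zero_prod_def fil_zero)
  qed
  show "\<exists>l. fil_converges hat_fil s l" if "fil_cauchy hat_fil s" for s
    by (rule hat_fil_complete) (rule that)
  show "hat_brk a b \<in> hat_fil (p + q)" if a: "a \<in> hat_fil p" and b: "b \<in> hat_fil q" for p q a b
  proof (cases "p = 0 \<and> q = 0")
    case False
    have "brk A (snd a) (snd b) \<in> fil A (p + q)"
      by (intro fil_brk hat_fil_snd a b)
    moreover have "scl A (fst a) (dif A (snd b)) \<in> fil A (p + q)"
    proof (cases "p = 0")
      case True
      then show ?thesis
        using fil_dif[OF hat_fil_snd[OF b]] by (auto intro: fil_scale fil_mono)
    qed (simp add: hat_fil_fst[OF a] fil_zero)
    moreover have "scl A (fst b) (dif A (snd a)) \<in> fil A (p + q)"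
    proof (cases "q = 0")
      case True
      then show ?thesis
        using fil_dif[OF hat_fil_snd[OF a]] by (auto intro: fil_scale fil_mono)
    qed (simp add: hat_fil_fst[OF b] fil_zero)
    ultimately show ?thesis
      unfolding hat_brk_def by (intro hat_filI fil_add)
  qed (simp add: hat_fil_def)
  show "hat_vs.subspace hat_odd"
    by (rule hat_vs.subspaceI) (auto simp: hat_odd_def hat_scale_def zero_prod_def intro: gr_mem)
  show "l \<in> hat_odd" if s: "\<And>n. s n \<in> hat_odd" and l: "fil_converges hat_fil s l" for s l
  proof -
    obtain N where "s N - l \<in> hat_fil 1"
      using l unfolding fil_converges_def by blast
    then have "fst (s N - l) = 0" by (rule hat_fil_fst) simp
    then have "fst l = 0" using s[of N] by (auto simp: hat_odd_def)
    moreover have "fil_converges (fil A) (\<lambda>n. snd (s n)) (snd l)"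
      using l hat_fil_snd unfolding fil_converges_def by (metis snd_diff)
    then have "snd l \<in> gr A 1"
      by (rule gr_closed[rotated]) (use s in \<open>simp add: hat_odd_def mem_Times_iff\<close>)
    ultimately show ?thesis by (auto simp: hat_odd_def mem_Times_iff)
  qed
  show "hat_brk a b \<in> hat_odd" if "a \<in> hat_odd" "b \<in> hat_odd" for a b
    using that by (auto simp: hat_odd_def hat_brk_def brk_odd_odd)
  show "hat_brk a a = 0" if "a \<in> hat_odd" for a
    using that by (auto simp: hat_odd_def hat_brk_def brk_odd_self zero_prod_def)
  show "hat_brk y (hat_brk a b) = hat_brk (hat_brk y a) b + hat_brk a (hat_brk y b)"
    if y: "y \<in> hat_odd" for y a b
  proof -
    obtain v where v: "y = (0, v)" "v \<in> gr A 1" using y by (auto simp: hat_odd_def)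
    \<comment> \<open>Terms linear in \<delta> give the rule for d{v,b}, applied in both arguments
      thanks to the symmetry of the even element dv; terms quadratic in \<delta> vanish by dd =
      0.\<close>
    show ?thesis
      by (simp add: hat_brk_def v brk_simps dif_simps dif_dif jacobi_odd dif_brk_odd
          brk_even_sym[OF dif_even[OF v(2)]] algebra_simps)
  qed
qed

interpretation hat: complete_leibniz hat_scale hat_brk hat_fil hat_odd
  by (rule hat_complete_leibniz)

section \<open>The gauge action as a linear exponential\<close>

definition gauge_term :: "'a \<Rightarrow> 'a \<Rightarrow> nat \<Rightarrow> 'a" where
  "gauge_term y x i = scl A (1 / fact (i + 1)) ((brk A y ^^ i) (dif A y + brk A y x))"

lemma gauge_act_eq: "gauge_act A y x = x + fil_suminf (fil A) (gauge_term y x)"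
  unfolding gauge_act_def gauge_term_def ..

text \<open>One bracket with y turns \<delta> + x into dy + {y,x}, which is free of \<delta>; from
  then on only {y,-} acts. Hence the factor 1/(i+1)! and the extra degree in the error
  bound.\<close>

lemma hat_lexp_and_gauge_approx:
  assumes y: "y \<in> fil A 1"
  shows "hat.lexp (0, y) (1, x) = (1, gauge_act A y x)"
    and "gauge_act A y x - (x + (\<Sum>i<n. gauge_term y x i)) \<in> fil A (Suc n)"
proof -
  let ?l = "hat.lexp (0, y) (1, x)"
  have pow: "(hat_brk (0, y) ^^ Suc i) (1, x) = (0, (brk A y ^^ i) (dif A y + brk A y x))" for i
    by (induction i) (simp_all add: hat_brk_def add.commute)
  have part: "(\<Sum>k<Suc n. hat_scale (1 / fact k) ((hat_brk (0, y) ^^ k) (1, x)))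
      = (1, x + (\<Sum>i<n. gauge_term y x i))" for n
  proof (induction n)
    case (Suc n)
    then show ?case
      unfolding sum.lessThan_Suc[of _ "Suc n"] pow
      by (simp add: hat_scale_def gauge_term_def add.assoc del: sum.lessThan_Suc fact_Suc)
        (simp add: sum.lessThan_Suc add.assoc)
  qed (simp add: hat_scale_def)
  have approx: "?l - (1, x + (\<Sum>i<n. gauge_term y x i)) \<in> hat_fil (Suc n)" for n
    unfolding part[symmetric] by (rule hat.lexp_approx_sum) (rule hat_filI[OF y])
  have fst: "fst ?l = 1"
    using hat_fil_fst[OF approx] by simp
  have snd: "snd ?l - (x + (\<Sum>i<n. gauge_term y x i)) \<in> fil A (Suc n)" for n
    using hat_fil_snd[OF approx[of n]] by simp
  have "fil_suminf (fil A) (gauge_term y x) = snd ?l - x"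
  proof (rule fil_suminf_eqI[OF fil_diff fil_hausdorff])
    show "fil_converges (fil A) (\<lambda>n. \<Sum>i<n. gauge_term y x i) (snd ?l - x)"
      unfolding fil_converges_def
    proof (intro allI exI impI)
      fix p n :: nat assume "p \<le> n"
      then have "- (snd ?l - (x + (\<Sum>i<n. gauge_term y x i))) \<in> fil A p"
        by (intro fil_neg fil_mono[OF snd]) simp
      then show "(\<Sum>i<n. gauge_term y x i) - (snd ?l - x) \<in> fil A p"
        by (simp add: algebra_simps)
    qed
  qed
  then have "snd ?l = gauge_act A y x"
    by (simp add: gauge_act_eq)
  then show "?l = (1, gauge_act A y x)"
    and "gauge_act A y x - (x + (\<Sum>i<n. gauge_term y x i)) \<in> fil A (Suc n)"
    using fst snd[of n] by (simp_all add: prod_eq_iff)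
qed

lemmas hat_lexp_eq = hat_lexp_and_gauge_approx(1)
  and gauge_approx_sum = hat_lexp_and_gauge_approx(2)

lemma gauge_converges:
  assumes "y \<in> fil A 1"
  shows "fil_converges (fil A) (\<lambda>n. x + (\<Sum>i<n. gauge_term y x i)) (gauge_act A y x)"
  unfolding fil_converges_def
proof (intro allI exI impI)
  fix p n :: nat assume "p \<le> n"
  then have "- (gauge_act A y x - (x + (\<Sum>i<n. gauge_term y x i))) \<in> fil A p"
    by (intro fil_neg fil_mono[OF gauge_approx_sum[OF assms]]) simp
  then show "x + (\<Sum>i<n. gauge_term y x i) - gauge_act A y x \<in> fil A p" by simp
qed

lemma gauge_fix:
  assumes "dif A y + brk A y x = 0"
  shows "gauge_act A y x = x"
proof -
  have "(brk A y ^^ i) 0 = 0" for i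
    by (induction i) (simp_all add: brk_simps)
  then have "gauge_term y x = (\<lambda>i. 0)"
    by (simp add: gauge_term_def fun_eq_iff assms)
  moreover have "fil_suminf (fil A) (\<lambda>i. 0) = 0"
    by (rule fil_suminf_eqI[OF fil_diff fil_hausdorff]) (simp_all add: fil_converges_def fil_zero)
  ultimately show ?thesis by (simp add: gauge_act_eq)
qed

lemma gauge_zero: "gauge_act A 0 x = x"
  by (rule gauge_fix) (simp add: brk_simps dif_simps)

lemma gauge_inverse:
  assumes "y \<in> fil A 1" "y \<in> gr A 1"
  shows "gauge_act A y (gauge_act A (- y) x) = x"
  using hat.lexp_inverse[of "(0, y)" "(1, x)"] assms
  by (simp add: hat_odd_def hat_filI hat_lexp_eq fil_neg)

lemma gauge_comp:
  assumes "1 \<le> n" "y \<in> fil A n" "y \<in> gr A 1" "z \<in> fil A 1" "z \<in> gr A 1"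
  obtains w where "w \<in> fil A 1" "w \<in> gr A 1" "w - (y + z) \<in> fil A (Suc n)"
    and "\<And>x. gauge_act A w x = gauge_act A y (gauge_act A z x)"
proof -
  have y1: "y \<in> fil A 1" using assms(1,2) fil_mono by blast
  obtain W where W: "W \<in> hat_odd" "W \<in> hat_fil 1" "W - ((0, y) + (0, z)) \<in> hat_fil (Suc n)"
    "\<And>x. hat.lexp W x = hat.lexp (0, y) (hat.lexp (0, z) x)"
    using hat.baker_campbell_hausdorff[of n "(0, y)" "(0, z)"] assms
    by (auto simp: hat_odd_def hat_filI)
  obtain w where w: "W = (0, w)" "w \<in> gr A 1" using W(1) by (auto simp: hat_odd_def)
  have w1: "w \<in> fil A 1" using hat_fil_snd[OF W(2)] by (simp add: w)
  show ?thesis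
  proof
    show "w - (y + z) \<in> fil A (Suc n)"
      using hat_fil_snd[OF W(3)] by (simp add: w)
    show "gauge_act A w x = gauge_act A y (gauge_act A z x)" for x
      using W(4)[of "(1, x)"] by (simp add: w hat_lexp_eq[OF w1] hat_lexp_eq[OF y1] hat_lexp_eq[OF assms(4)])
  qed (fact w1 w)+
qed

text \<open>The linear term of the exponential also contains dy, but d raises the filtration, so dy
  lies in F_(n+1).\<close>

lemma gauge_linear_approx:
  assumes "1 \<le> n" "y \<in> fil A n"
  shows "gauge_act A y x - (x + brk A y x) \<in> fil A (Suc n)"
proof -
  have y1: "y \<in> fil A 1" using assms fil_mono by blast
  have "hat.lexp (0, y) (1, x) - ((1, x) + hat_brk (0, y) (1, x)) \<in> hat_fil (Suc n)"
    by (intro hat.lexp_linear_approx assms(1) hat_filI assms(2))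
  from hat_fil_snd[OF this] have "gauge_act A y x - (x + (brk A y x + dif A y)) \<in> fil A (Suc n)"
    by (simp add: hat_lexp_eq[OF y1] hat_brk_def)
  from fil_add[OF this fil_dif_Suc[OF assms(2)]] show ?thesis by (simp add: algebra_simps)
qed

lemma gauge_diff_fil:
  assumes "1 \<le> n" "y \<in> fil A n"
  shows "gauge_act A y x - x \<in> fil A n"
proof -
  have "gauge_act A y x - (x + brk A y x) \<in> fil A n"
    using gauge_linear_approx[OF assms] fil_decreasing by blast
  from fil_add[OF this fil_brk_left[OF assms(2), of x]] show ?thesis by (simp add: algebra_simps)
qed

lemma gauge_continuous:
  assumes "y \<in> fil A 1" "y' \<in> fil A 1" "y - y' \<in> fil A n"
  shows "gauge_act A y x - gauge_act A y' x \<in> fil A n"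
proof -
  have "hat.lexp (0, y) (1, x) - hat.lexp (0, y') (1, x) \<in> hat_fil n"
    by (rule hat.lexp_continuous) (use assms in \<open>auto intro: hat_filI\<close>)
  from hat_fil_snd[OF this] show ?thesis by (simp add: hat_lexp_eq[OF assms(1)] hat_lexp_eq[OF assms(2)])
qed

lemma gauge_even:
  assumes y: "y \<in> fil A 1" "y \<in> gr A 1" and x: "x \<in> gr A 0"
  shows "gauge_act A y x \<in> gr A 0"
proof (rule gr_closed)
  have "(brk A y ^^ i) (dif A y + brk A y x) \<in> gr A 0" for i
    by (induction i) (auto intro: gr_mem brk_odd_even dif_even y x)
  then show "x + (\<Sum>i<n. gauge_term y x i) \<in> gr A 0" for n
    unfolding gauge_term_def by (intro gr_mem x)
qed (rule gauge_converges[OF y(1)])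

section \<open>Maurer-Cartan elements and gauge equivalence\<close>

definition curvature :: "'a \<Rightarrow> 'a" where
  "curvature x = dif A x + scl A (1 / 2) (brk A x x)"

lemma MC_iff: "x \<in> MC A \<longleftrightarrow> x \<in> gr A 0 \<and> curvature x = 0"
  by (simp add: MC_def curvature_def)

lemma curvature_eq_0_iff: "curvature x = 0 \<longleftrightarrow> hat_brk (1, x) (1, x) = 0"
proof -
  have half: "scl A (1 / 2) v + scl A (1 / 2) v = v" for v
    by (simp flip: scale_left_distrib)
  have "scl A 2 (curvature x) = curvature x + curvature x"
    using scale_left_distrib[of 1 1 "curvature x"] by simp
  also have "\<dots> = (scl A (1 / 2) (brk A x x) + scl A (1 / 2) (brk A x x)) + dif A x + dif A x"
    by (simp only: curvature_def ac_simps)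
  finally have "hat_brk (1, x) (1, x) = (0, scl A 2 (curvature x))"
    by (simp add: half hat_brk_def)
  then show ?thesis by (simp add: zero_prod_def)
qed

text \<open>\<open>hat.lexp\<close> preserves brackets, hence it preserves the condition that
  \<delta> + x brackets with itself to zero.\<close>

lemma gauge_MC:
  assumes "x \<in> MC A" "y \<in> fil A 1" "y \<in> gr A 1"
  shows "gauge_act A y x \<in> MC A"
proof -
  have "hat_brk (1, gauge_act A y x) (1, gauge_act A y x) = hat.lexp (0, y) (hat_brk (1, x) (1, x))"
    using assms by (simp add: hat.lexp_br hat_odd_def hat_filI hat_lexp_eq)
  also have "hat_brk (1, x) (1, x) = 0"
    using assms(1) by (simp add: MC_iff curvature_eq_0_iff)
  finally show ?thesis
    using assms by (simp add: hat.lexp_zero MC_iff curvature_eq_0_iff gauge_even)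
qed

lemma gauge_rel_iff: "(x, x') \<in> gauge_rel A \<longleftrightarrow>
    x \<in> MC A \<and> (\<exists>y \<in> fil A 1 \<inter> gr A 1. x' = gauge_act A y x)"
  by (auto simp: gauge_rel_def)

lemma equiv_gauge_rel: "equiv (MC A) (gauge_rel A)"
proof (rule equivI)
  show "gauge_rel A \<subseteq> MC A \<times> MC A"
    by (auto simp: gauge_rel_iff gauge_MC)
  show "refl_on (MC A) (gauge_rel A)"
  proof (rule refl_onI)
    fix x assume "x \<in> MC A"
    then show "(x, x) \<in> gauge_rel A"
      by (auto simp: gauge_rel_iff gauge_zero fil_zero gr_mem intro!: bexI[of _ 0])
  qed
  show "sym (gauge_rel A)"
  proof (rule symI)
    fix x x' assume "(x, x') \<in> gauge_rel A"
    then obtain y where y: "x \<in> MC A" "y \<in> fil A 1" "y \<in> gr A 1" "x' = gauge_act A y x"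
      by (auto simp: gauge_rel_iff)
    have "x = gauge_act A (- y) x'"
      using gauge_inverse[of "- y" x] y by (simp add: fil_neg gr_mem)
    then show "(x', x) \<in> gauge_rel A"
      using y by (auto simp: gauge_rel_iff gauge_MC fil_neg gr_mem intro!: bexI[of _ "- y"])
  qed
  show "trans (gauge_rel A)"
  proof (rule transI)
    fix a b c assume "(a, b) \<in> gauge_rel A" "(b, c) \<in> gauge_rel A"
    then obtain y z where yz: "a \<in> MC A" "z \<in> fil A 1" "z \<in> gr A 1" "y \<in> fil A 1" "y \<in> gr A 1"
      "c = gauge_act A y (gauge_act A z a)"
      by (auto simp: gauge_rel_iff)
    obtain w where w: "w \<in> fil A 1" "w \<in> gr A 1" "\<And>x. gauge_act A w x = gauge_act A y (gauge_act A z x)"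
      using gauge_comp[of 1 y z] yz by auto
    then have "c = gauge_act A w a" using yz(6) by simp
    then show "(a, c) \<in> gauge_rel A" using yz(1) w(1,2) unfolding gauge_rel_iff by blast
  qed
qed

end

text \<open>f commutes with the finite partial sums, and preservation of the filtration carries the
  equality to the limit.\<close>

lemma (in filtered_dgla_map) map_gauge:
  assumes "y \<in> fil G 1"
  shows "f (gauge_act G y x) = gauge_act H (f y) (f x)"
proof -
  have pow: "f ((brk G y ^^ i) v) = (brk H (f y) ^^ i) (f v)" for i v
    by (induction i) (simp_all add: map_brk)
  have part: "f (x + (\<Sum>i<n. G.gauge_term y x i)) = f x + (\<Sum>i<n. H.gauge_term (f y) (f x) i)" for n
    by (simp add: G.gauge_term_def H.gauge_term_def add sum scale pow map_dif map_brk)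
  have "f (gauge_act G y x) - gauge_act H (f y) (f x) \<in> fil H n" for n
  proof -
    have "f (gauge_act G y x - (x + (\<Sum>i<n. G.gauge_term y x i))) \<in> fil H (Suc n)"
      by (intro map_fil G.gauge_approx_sum assms)
    then have "f (gauge_act G y x) - (f x + (\<Sum>i<n. H.gauge_term (f y) (f x) i)) \<in> fil H (Suc n)"
      by (simp only: diff part)
    from H.fil_diff[OF this H.gauge_approx_sum[OF map_fil[OF assms], of "f x" n]]
    show ?thesis using H.fil_decreasing by auto
  qed
  then have "f (gauge_act G y x) - gauge_act H (f y) (f x) = 0" by (rule H.zero_if_fil)
  then show ?thesis by simp
qed

section \<open>Curvature and graded cohomology\<close>

context odd_dgla
begin

lemma scale_half_double: "scl A (1 / 2) (a + a) = a"
proof -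
  have "a + a = scl A 2 a"
    using scale_left_distrib[of 1 1 a] by simp
  then show ?thesis by simp
qed

text \<open>The Jacobi identity for three equal even elements reads t = -t - t, so 3t = 0, and 3 is
  invertible.\<close>

lemma brk_even_brk_self:
  assumes x: "x \<in> gr A 0"
  shows "brk A x (brk A x x) = 0"
proof -
  let ?t = "brk A x (brk A x x)"
  have "?t = - ?t - ?t"
    using jacobi[OF x x, of x] brk_even_sym[OF x, of "brk A x x"] by (simp add: ksign_def)
  then have "?t + ?t + ?t = 0" by (metis add.assoc add.inverse_inverse add_uminus_conv_diff
        diff_add_cancel minus_add_distrib right_minus)
  moreover have "scl A 3 ?t = ?t + ?t + ?t"
    using scale_left_distrib[of 2 1 ?t] scale_left_distrib[of 1 1 ?t] by simp
  ultimately have "scl A 3 ?t = 0" by simp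
  then show ?thesis by simp
qed

lemma brk_even_brk:
  assumes x: "x \<in> gr A 0"
  shows "brk A x (brk A x k) = - scl A (1 / 2) (brk A (brk A x x) k)"
proof -
  have "brk A x (brk A x k) = - brk A (brk A x x) k - brk A x (brk A x k)"
    using jacobi[OF x x, of k] by (simp add: ksign_def)
  then have "brk A x (brk A x k) + brk A x (brk A x k) = - brk A (brk A x x) k"
    by (metis diff_add_cancel)
  then show ?thesis
    using scale_half_double[of "brk A x (brk A x k)"] by simp
qed

end

context strongly_filtered_dgla
begin

lemma curvature_odd: "x \<in> gr A 0 \<Longrightarrow> curvature x \<in> gr A 1"
  using dif_odd[of x 0] brk_odd[of x 0 x 0] unfolding curvature_def by (auto intro: gr_mem)

lemma curvature_add:
  assumes "x \<in> gr A 0"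
  shows "curvature (x + e) = curvature x + dif A e + brk A x e + scl A (1 / 2) (brk A e e)"
proof -
  have "brk A (x + e) (x + e) = brk A x x + (brk A x e + brk A x e) + brk A e e"
    using brk_even_sym[OF assms, of e] by (simp add: brk_simps)
  then have "scl A (1 / 2) (brk A (x + e) (x + e))
      = scl A (1 / 2) (brk A x x) + scl A (1 / 2) (brk A x e + brk A x e) + scl A (1 / 2) (brk A e e)"
    by (simp only: scale_right_distrib)
  then show ?thesis
    unfolding scale_half_double by (simp add: curvature_def dif_simps algebra_simps)
qed

text \<open>Since d{x,x} = -2{x,dx} and {x,{x,x}} = 0, both sides reduce to {x,dx}. If the curvature
  lies in F_n, its differential lies in F_(n+1), so it is a cocycle to that order.\<close>

lemma bianchi:
  assumes "x \<in> gr A 0"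
  shows "brk A x (curvature x) = - dif A (curvature x)"
proof -
  have "dif A (brk A x x) = - (brk A x (dif A x) + brk A x (dif A x))"
    using dif_brk[OF assms, of x] brk_even_sym[OF assms, of "dif A x"] by (simp add: ksign_def)
  then have "dif A (curvature x) = - brk A x (dif A x)"
    by (simp only: curvature_def dif_simps dif_dif add_0_left scale_minus_right scale_half_double)
  moreover have "brk A x (curvature x) = brk A x (dif A x)"
    by (simp add: curvature_def brk_simps brk_even_brk_self[OF assms])
  ultimately show ?thesis by simp
qed

text \<open>The twisted differential d + {x,-} squares to minus the bracket with the curvature,
  which vanishes here. By \<open>gauge_fix\<close>, exp y then stabilises x; injectivity on moduli
  uses this freedom.\<close>

lemma twisted_dif_square:
  assumes x: "x \<in> MC A" and k: "k \<in> gr A 0"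
  defines "y \<equiv> dif A k + brk A x k"
  shows "dif A y + brk A y x = 0"
proof -
  have x0: "x \<in> gr A 0" and curv: "dif A x + scl A (1 / 2) (brk A x x) = 0"
    using x by (auto simp: MC_def)
  have "brk A y x = brk A x y"
    using brk_even_sym[OF x0] by simp
  moreover have "dif A (brk A x k) = - brk A (dif A x) k - brk A x (dif A k)"
    using dif_brk[OF x0, of k] by (simp add: ksign_def)
  ultimately have "dif A y + brk A y x = - brk A (dif A x + scl A (1 / 2) (brk A x x)) k"
    by (simp add: y_def dif_simps brk_simps dif_dif brk_even_brk[OF x0])
  then show ?thesis by (simp add: curv brk_simps)
qed

text \<open>de gains one degree because the filtration is strong, and {e,e} lies in F_(2n) with 2n
  \<ge> n + 1.\<close>

lemma curvature_add_approx:
  assumes "x \<in> gr A 0" "e \<in> fil A n" "1 \<le> n"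
  shows "curvature (x + e) - (curvature x + brk A x e) \<in> fil A (Suc n)"
proof -
  have "dif A e + scl A (1 / 2) (brk A e e) \<in> fil A (Suc n)"
    using assms by (intro fil_add fil_scale fil_dif_Suc fil_brk_ge[OF assms(2) assms(2)]) auto
  then show ?thesis unfolding curvature_add[OF assms(1)] by (simp add: algebra_simps)
qed

lemma curvature_add_fil:
  assumes "x \<in> gr A 0" "e \<in> fil A n"
  shows "curvature (x + e) - curvature x \<in> fil A n"
proof -
  have "dif A e + brk A x e + scl A (1 / 2) (brk A e e) \<in> fil A n"
    using assms fil_dif_Suc[of e n] fil_mono[of _ "Suc n" n]
    by (intro fil_add fil_scale fil_brk_right) auto
  then show ?thesis unfolding curvature_add[OF assms(1)] by (simp add: algebra_simps)
qed

text \<open>Cocycle conditions modulo F_(m+1) see only the class of x modulo F_1. Changing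
  approximate solutions can thus be exchanged for one fixed lift of \<open>x0\<close>.\<close>

lemma brk_base_change:
  assumes "x - x' \<in> fil A 1" "r \<in> fil A m"
  shows "brk A x r - brk A x' r \<in> fil A (Suc m)"
  using fil_brk[OF assms] by (simp add: brk_simps)

lemma fil_limit:
  assumes "\<And>n. s (Suc n) - s n \<in> fil A n"
  obtains l where "\<And>n. l - s n \<in> fil A n"
  by (rule fil_limit_exists[of "fil A" s])
    (use fil_zero fil_diff fil_decreasing fil_complete assms in auto)

lemma gr_limit:
  assumes "\<And>n. s n \<in> gr A i" "\<And>n. l - s n \<in> fil A n"
  shows "l \<in> gr A i"
proof (rule gr_closed[OF assms(1)])
  show "fil_converges (fil A) s l"
    unfolding fil_converges_def
  proof (intro allI exI impI)
    fix p n :: nat assume "p \<le> n"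
    from fil_neg[OF fil_mono[OF assms(2) this]] show "s n - l \<in> fil A p" by simp
  qed
qed

section \<open>Cosets and explicit cohomology classes\<close>

lemma mem_coset_iff: "v \<in> u +o fil A p \<longleftrightarrow> v - u \<in> fil A p"
  by (auto simp: elt_set_plus_def algebra_simps intro!: bexI[of _ "v - u"])

lemma coset_eq_iff: "u +o fil A p = v +o fil A p \<longleftrightarrow> u - v \<in> fil A p"
proof
  assume "u +o fil A p = v +o fil A p"
  moreover have "u \<in> u +o fil A p" by (simp add: mem_coset_iff fil_zero)
  ultimately show "u - v \<in> fil A p" by (simp add: mem_coset_iff)
next
  assume uv: "u - v \<in> fil A p"
  have "w - u \<in> fil A p \<longleftrightarrow> w - v \<in> fil A p" for w
    using fil_add[OF uv, of "w - u"] fil_diff[OF _ uv, of "w - v"] by auto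
  then show "u +o fil A p = v +o fil A p"
    by (auto simp: mem_coset_iff set_eq_iff)
qed

lemma coset_add: "(u +o fil A p) + (v +o fil A p) = (u + v) +o fil A p"
proof -
  have "fil A p + fil A p = fil A p"
    using fil_add fil_zero by (force simp: set_plus_def)
  then show ?thesis by (simp add: set_plus_rearrange)
qed

lemma quot_brk_coset:
  assumes r: "r \<in> fil A m"
  shows "quot_brk A (fil A (m + 1)) (x +o fil A 1) (r +o fil A (m + 1)) = brk A x r +o fil A (m + 1)"
proof
  show "quot_brk A (fil A (m + 1)) (x +o fil A 1) (r +o fil A (m + 1)) \<subseteq> brk A x r +o fil A (m + 1)"
  proof
    fix v assume "v \<in> quot_brk A (fil A (m + 1)) (x +o fil A 1) (r +o fil A (m + 1))"
    then obtain x' r' w where v: "v = brk A x' r' + w" and x': "x' - x \<in> fil A 1"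
      and r': "r' - r \<in> fil A (m + 1)" and w: "w \<in> fil A (m + 1)"
      by (auto simp: quot_brk_def set_plus_def mem_coset_iff)
    have "brk A x' (r' - r) \<in> fil A (m + 1)" "brk A (x' - x) r \<in> fil A (m + 1)"
      using fil_brk[OF x' r] r'
      by (auto intro: fil_brk_right)
    from fil_add[OF fil_add[OF this] w] show "v \<in> brk A x r +o fil A (m + 1)"
      by (simp add: mem_coset_iff v brk_simps algebra_simps)
  qed
  show "brk A x r +o fil A (m + 1) \<subseteq> quot_brk A (fil A (m + 1)) (x +o fil A 1) (r +o fil A (m + 1))"
  proof
    fix v assume "v \<in> brk A x r +o fil A (m + 1)"
    then obtain w where "v = brk A x r + w" "w \<in> fil A (m + 1)"
      by (auto simp: elt_set_plus_def)
    moreover have "x \<in> x +o fil A 1" "r \<in> r +o fil A (m + 1)"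
      by (simp_all add: mem_coset_iff fil_zero)
    ultimately show "v \<in> quot_brk A (fil A (m + 1)) (x +o fil A 1) (r +o fil A (m + 1))"
      unfolding quot_brk_def by blast
  qed
qed

text \<open>The cohomology class of r, as a set of cosets described by representatives in g. It
  unfolds the nested quotients once; afterwards only elements and memberships in F_p occur.\<close>

definition gr_class :: "'a \<Rightarrow> nat \<Rightarrow> bit \<Rightarrow> 'a \<Rightarrow> 'a set set" where
  "gr_class x m i r = {(r + brk A x b) +o fil A (m + 1) | b. b \<in> fil A m \<inter> gr A (i + 1)}"

lemma gr_class_image:
  "gr_class x m i r = (\<lambda>b. (r + brk A x b) +o fil A (m + 1)) ` (fil A m \<inter> gr A (i + 1))"
  by (simp only: gr_class_def image_def) blast

lemma gr_coboundaries_eq: "gr_coboundaries A (x +o fil A 1) m i = gr_class x m i 0"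
proof -
  have "gr_coboundaries A (x +o fil A 1) m i
      = (\<lambda>b. quot_brk A (fil A (m + 1)) (x +o fil A 1) (b +o fil A (m + 1))) ` (fil A m \<inter> gr A (i + 1))"
    by (simp add: gr_coboundaries_def gr_chains_def quot_def image_image)
  also have "\<dots> = (\<lambda>b. brk A x b +o fil A (m + 1)) ` (fil A m \<inter> gr A (i + 1))"
    by (intro image_cong refl quot_brk_coset) simp
  finally show ?thesis by (auto simp: gr_class_def)
qed

lemma coset_plus_coboundaries:
  "(r +o fil A (m + 1)) +o gr_coboundaries A (x +o fil A 1) m i = gr_class x m i r"
proof -
  have plus: "u +o B = (+) u ` B" for u :: "'a set" and B
    by (auto simp: elt_set_plus_def)
  show ?thesis
    by (simp only: gr_coboundaries_eq gr_class_image plus image_image coset_add add_0_left)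
qed

lemma gr_cohomology_eq:
  "gr_cohomology A (x +o fil A 1) m i
    = gr_class x m i ` {r \<in> fil A m \<inter> gr A i. brk A x r \<in> fil A (m + 1)}"
proof -
  have zero: "0 +o fil A p = fil A p" for p
    by (simp add: elt_set_plus_def)
  have "quot_brk A (fil A (m + 1)) (x +o fil A 1) (r +o fil A (m + 1)) = fil A (m + 1)
      \<longleftrightarrow> brk A x r \<in> fil A (m + 1)" if "r \<in> fil A m" for r
    unfolding quot_brk_coset[OF that] using coset_eq_iff[of "brk A x r" "m + 1" 0] by (simp add: zero)
  then have "gr_cocycles A (x +o fil A 1) m i
      = (\<lambda>r. r +o fil A (m + 1)) ` {r \<in> fil A m \<inter> gr A i. brk A x r \<in> fil A (m + 1)}"
    unfolding gr_cocycles_def gr_chains_def quot_def by blast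
  then show ?thesis
    unfolding gr_cohomology_def quot_def image_image
    by (simp only: image_image coset_plus_coboundaries)
qed

lemma mem_gr_class_iff: "r +o fil A (m + 1) \<in> gr_class x m i s \<longleftrightarrow>
    (\<exists>b \<in> fil A m \<inter> gr A (i + 1). r - s - brk A x b \<in> fil A (m + 1))"
  by (auto simp: gr_class_def coset_eq_iff diff_diff_eq)

lemma gr_class_mono:
  assumes e: "e \<in> fil A m" "e \<in> gr A (i + 1)" and rs: "r - s - brk A x e \<in> fil A (m + 1)"
  shows "gr_class x m i r \<subseteq> gr_class x m i s"
proof
  fix C assume "C \<in> gr_class x m i r"
  then obtain b where b: "b \<in> fil A m" "b \<in> gr A (i + 1)" "C = (r + brk A x b) +o fil A (m + 1)"
    by (auto simp: gr_class_def)
  have "(r + brk A x b) - s - brk A x (b + e) \<in> fil A (m + 1)"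
    using rs by (simp add: brk_simps algebra_simps)
  then show "C \<in> gr_class x m i s"
    unfolding b(3) mem_gr_class_iff using b e by (intro bexI[of _ "b + e"]) (auto intro: fil_add gr_mem)
qed

lemma gr_class_eqI:
  assumes e: "e \<in> fil A m" "e \<in> gr A (i + 1)" and rs: "r - s - brk A x e \<in> fil A (m + 1)"
  shows "gr_class x m i r = gr_class x m i s"
proof
  show "gr_class x m i r \<subseteq> gr_class x m i s" by (rule gr_class_mono[OF assms])
  show "gr_class x m i s \<subseteq> gr_class x m i r"
    using fil_neg[OF rs] e
    by (intro gr_class_mono[of "- e"]) (auto simp: brk_simps algebra_simps intro: fil_neg gr_mem)
qed

lemma mem_gr_class_self: "r +o fil A (m + 1) \<in> gr_class x m i r"
  unfolding mem_gr_class_iff by (intro bexI[of _ 0]) (auto simp: brk_simps fil_zero gr_mem)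

lemma MC_fiber_iff: "y \<in> MC_fiber A (x +o fil A 1) \<longleftrightarrow> y \<in> MC A \<and> y - x \<in> fil A 1"
  by (simp add: MC_fiber_def coset_eq_iff)

end

context filtered_dgla_map
begin

lemma induced_coset: "induced f (fil H p) (u +o fil G p) = f u +o fil H p"
proof -
  have "f ` (u +o fil G p) + fil H p = {f u + f a + b | a b. a \<in> fil G p \<and> b \<in> fil H p}"
    by (force simp: set_plus_def elt_set_plus_def add)
  also have "\<dots> = f u +o fil H p"
  proof
    show "{f u + f a + b | a b. a \<in> fil G p \<and> b \<in> fil H p} \<subseteq> f u +o fil H p"
      by (auto simp: H.mem_coset_iff intro!: H.fil_add map_fil)
    show "f u +o fil H p \<subseteq> {f u + f a + b | a b. a \<in> fil G p \<and> b \<in> fil H p}"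
      using G.fil_zero[of p] zero by (force simp: elt_set_plus_def)
  qed
  finally show ?thesis by (simp add: induced_def)
qed

text \<open>A coboundary coming from b in g is absorbed by the free primitive k in h; conversely b =
  0 already yields the whole target class.\<close>

lemma gr_cohomology_map_class:
  "gr_cohomology_map H f (f x +o fil H 1) m i (G.gr_class x m i r) = H.gr_class (f x) m i (f r)"
proof -
  let ?C = "\<lambda>v. v +o fil H (m + 1)"
  have "gr_cohomology_map H f (f x +o fil H 1) m i (G.gr_class x m i r)
      = (\<lambda>b. ?C (f r + brk H (f x) (f b))) ` (fil G m \<inter> gr G (i + 1)) + H.gr_class (f x) m i 0"
    unfolding gr_cohomology_map_def H.gr_coboundaries_eq induced_def[of "induced f (fil H (m + 1))"]
    by (simp only: G.gr_class_image image_image induced_coset add map_brk)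
  also have "\<dots> = H.gr_class (f x) m i (f r)"
  proof
    show "(\<lambda>b. ?C (f r + brk H (f x) (f b))) ` (fil G m \<inter> gr G (i + 1)) + H.gr_class (f x) m i 0
      \<subseteq> H.gr_class (f x) m i (f r)"
    proof
      fix K assume "K \<in> (\<lambda>b. ?C (f r + brk H (f x) (f b))) ` (fil G m \<inter> gr G (i + 1)) + H.gr_class (f x) m i 0"
      then obtain b k where b: "b \<in> fil G m" "b \<in> gr G (i + 1)" and k: "k \<in> fil H m" "k \<in> gr H (i + 1)"
        and K: "K = ?C (f r + brk H (f x) (f b)) + ?C (0 + brk H (f x) k)"
        by (auto simp: set_plus_def H.gr_class_def)
      have "K = ?C (f r + brk H (f x) (f b + k))"
        unfolding K H.coset_add by (simp add: H.brk_simps add.assoc)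
      moreover have "f b + k \<in> fil H m \<inter> gr H (i + 1)"
        using b k by (intro IntI H.fil_add H.gr_mem(2) map_fil map_gr)
      ultimately show "K \<in> H.gr_class (f x) m i (f r)"
        unfolding H.gr_class_def by blast
    qed
    show "H.gr_class (f x) m i (f r) \<subseteq>
      (\<lambda>b. ?C (f r + brk H (f x) (f b))) ` (fil G m \<inter> gr G (i + 1)) + H.gr_class (f x) m i 0"
    proof
      fix K assume "K \<in> H.gr_class (f x) m i (f r)"
      then obtain k where k: "k \<in> fil H m \<inter> gr H (i + 1)" "K = ?C (f r + brk H (f x) k)"
        by (auto simp: H.gr_class_def)
      have "K = ?C (f r + brk H (f x) (f 0)) + ?C (0 + brk H (f x) k)"
        unfolding H.coset_add k(2) by (simp add: H.brk_simps zero)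
      moreover have "?C (f r + brk H (f x) (f 0)) \<in> (\<lambda>b. ?C (f r + brk H (f x) (f b))) ` (fil G m \<inter> gr G (i + 1))"
        using G.fil_zero G.gr_mem(1) by blast
      moreover have "?C (0 + brk H (f x) k) \<in> H.gr_class (f x) m i 0"
        unfolding H.gr_class_def using k(1) by blast
      ultimately show "K \<in> (\<lambda>b. ?C (f r + brk H (f x) (f b))) ` (fil G m \<inter> gr G (i + 1)) + H.gr_class (f x) m i 0"
        by (auto intro: set_plus_intro)
    qed
  qed
  finally show ?thesis .
qed

text \<open>r and 0 have the same image class, hence the same class, and the coset of r inside the
  class of 0 exhibits a primitive b.\<close>

lemma cohomology_injD:
  assumes inj: "inj_on (gr_cohomology_map H f (f x +o fil H 1) m i) (gr_cohomology G (x +o fil G 1) m i)"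
    and r: "r \<in> fil G m" "r \<in> gr G i" "brk G x r \<in> fil G (Suc m)"
    and e: "e \<in> fil H m" "e \<in> gr H (i + 1)" "f r - brk H (f x) e \<in> fil H (Suc m)"
  obtains b where "b \<in> fil G m" "b \<in> gr G (i + 1)" "r - brk G x b \<in> fil G (Suc m)"
proof -
  have "H.gr_class (f x) m i (f r) = H.gr_class (f x) m i (f 0)"
    using e by (intro H.gr_class_eqI[of e]) (simp_all add: zero)
  then have "G.gr_class x m i r = G.gr_class x m i 0"
    unfolding gr_cohomology_map_class[symmetric]
    by (rule inj_onD[OF inj[unfolded G.gr_cohomology_eq]])
      (use r in \<open>auto simp: G.fil_zero G.gr_mem G.brk_simps\<close>)
  then have "r +o fil G (m + 1) \<in> G.gr_class x m i 0"
    using G.mem_gr_class_self by metis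
  then show ?thesis
    using that unfolding G.mem_gr_class_iff by auto
qed

text \<open>c represents a preimage of the class of e. The primitive k records that f c meets e only
  up to a coboundary, which gauge transformations will remove.\<close>

lemma cohomology_surjD:
  assumes surj: "gr_cohomology_map H f (f x +o fil H 1) m i ` gr_cohomology G (x +o fil G 1) m i
      = gr_cohomology H (f x +o fil H 1) m i"
    and e: "e \<in> fil H m" "e \<in> gr H i" "brk H (f x) e \<in> fil H (Suc m)"
  obtains c k where "c \<in> fil G m" "c \<in> gr G i" "brk G x c \<in> fil G (Suc m)"
    "k \<in> fil H m" "k \<in> gr H (i + 1)" "e - f c - brk H (f x) k \<in> fil H (Suc m)"
proof -
  have "H.gr_class (f x) m i e \<in> gr_cohomology H (f x +o fil H 1) m i"
    unfolding H.gr_cohomology_eq using e by auto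
  then obtain c where c: "c \<in> fil G m" "c \<in> gr G i" "brk G x c \<in> fil G (Suc m)"
    and "H.gr_class (f x) m i e = H.gr_class (f x) m i (f c)"
    unfolding surj[symmetric] G.gr_cohomology_eq image_image gr_cohomology_map_class by auto
  then have "e +o fil H (m + 1) \<in> H.gr_class (f x) m i (f c)"
    using H.mem_gr_class_self by metis
  then show ?thesis
    using that c unfolding H.mem_gr_class_iff by auto
qed

lemma map_curvature: "f (G.curvature x) = H.curvature (f x)"
  by (simp add: G.curvature_def H.curvature_def add scale map_dif map_brk)

lemma map_MC: "x \<in> MC G \<Longrightarrow> f x \<in> MC H"
  by (metis G.MC_iff H.MC_iff map_gr map_curvature zero)

end

section \<open>Lifting along the filtration\<close>

text \<open>x is one fixed lift of \<open>x0\<close>, in general not a Maurer-Cartan element; all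
  cocycle conditions are expressed through it.\<close>

locale graded_quasi_isomorphism = filtered_dgla_map G H f
  for G :: "('k::field_char_0, 'a::ab_group_add, 'y) filtered_dgla_scheme"
    and H :: "('k, 'b::ab_group_add, 'z) filtered_dgla_scheme"
    and f :: "'a \<Rightarrow> 'b" +
  fixes x :: 'a
  assumes x_even: "x \<in> gr G 0"
    and cohomology_bij: "\<And>m i. 1 \<le> m \<Longrightarrow>
      bij_betw (gr_cohomology_map H f (f x +o fil H 1) m i)
        (gr_cohomology G (x +o fil G 1) m i) (gr_cohomology H (f x +o fil H 1) m i)"
begin

lemmas cohomology_inj = cohomology_injD[OF bij_betw_imp_inj_on[OF cohomology_bij]]
  and cohomology_surj = cohomology_surjD[OF bij_betw_imp_surj_on[OF cohomology_bij]]

lemma map_base_change: "X - x \<in> fil G 1 \<Longrightarrow> f X - f x \<in> fil H 1"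
  using map_fil[of "X - x" 1] by (simp add: diff)

section \<open>Surjectivity on moduli\<close>

lemma lifting_step:
  assumes n: "1 \<le> n"
    and X: "X \<in> gr G 0" "X - x \<in> fil G 1" "G.curvature X \<in> fil G n"
    and z: "z \<in> MC H" "z - f X \<in> fil H n"
  obtains X' y where "X' \<in> gr G 0" "X' - X \<in> fil G n" "G.curvature X' \<in> fil G (Suc n)"
    and "y \<in> fil H n" "y \<in> gr H 1" "gauge_act H y z - f X' \<in> fil H (Suc n)"
proof -
  define r where "r = G.curvature X"
  define e where "e = z - f X"
  have z0: "z \<in> gr H 0" and z_curv: "H.curvature z = 0"
    using z(1) by (auto simp: H.MC_iff)
  have fX: "f X \<in> gr H 0" "f X - f x \<in> fil H 1"
    by (intro map_gr map_base_change X)+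
  have e: "e \<in> gr H 0" "e \<in> fil H n"
    using z0 fX z(2) by (auto simp: e_def intro: H.gr_mem)
  have r: "r \<in> fil G n" "r \<in> gr G 1"
    using X G.curvature_odd by (auto simp: r_def)
  have "brk G X r \<in> fil G (Suc n)"
    unfolding r_def G.bianchi[OF X(1)] by (intro G.fil_neg G.fil_dif_Suc X)
  from G.fil_diff[OF this G.brk_base_change[OF X(2) r(1)]]
  have xr: "brk G x r \<in> fil G (Suc n)" by simp
  \<comment> \<open>z has zero curvature, so expanding around f X shows that f r is, to this order,
    the coboundary of -e. The obstruction thus dies in h.\<close>
  have "f X + e = z" by (simp add: e_def)
  then have "- (f r + brk H (f X) e) \<in> fil H (Suc n)"
    using H.curvature_add_approx[OF fX(1) e(2) n] by (simp add: z_curv r_def map_curvature)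
  from H.fil_add[OF H.fil_neg[OF this] H.fil_neg[OF H.brk_base_change[OF fX(2) e(2)]]]
  have "f r - brk H (f x) (- e) \<in> fil H (Suc n)"
    by (simp add: H.brk_simps)
  then obtain b where b: "b \<in> fil G n" "b \<in> gr G 0" "r - brk G x b \<in> fil G (Suc n)"
    using cohomology_inj[OF n r xr, of "- e"] e by (auto intro: H.fil_neg H.gr_mem)
  \<comment> \<open>Subtracting b pushes the curvature into F_(n+1), but it changes the discrepancy
    with z by f b, so this discrepancy is recomputed as \<open>e1\<close>.\<close>
  define X1 where "X1 = X + (- b)"
  have nb: "- b \<in> fil G n" using b G.fil_neg by blast
  have X1: "X1 \<in> gr G 0" "X1 - x \<in> fil G 1"
  proof -
    show "X1 \<in> gr G 0" using X b by (auto simp: X1_def intro: G.gr_mem)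
    show "X1 - x \<in> fil G 1"
      using G.fil_diff[OF X(2) G.fil_mono[OF b(1) n]] by (simp add: X1_def algebra_simps)
  qed
  have curv1: "G.curvature X1 \<in> fil G (Suc n)"
    using G.fil_add[OF G.fil_add[OF G.curvature_add_approx[OF X(1) nb n]
        G.brk_base_change[OF X(2) nb]] b(3)]
    by (simp add: X1_def r_def G.brk_simps)
  have fX1: "f X1 \<in> gr H 0" "f X1 - f x \<in> fil H 1"
    by (intro map_gr map_base_change X1)+
  define e1 where "e1 = z - f X1"
  have e1: "e1 \<in> gr H 0" "e1 \<in> fil H n"
  proof -
    show "e1 \<in> gr H 0" using z0 fX1 by (auto simp: e1_def intro: H.gr_mem)
    show "e1 \<in> fil H n"
      using H.fil_add[OF z(2) map_fil[OF b(1)]] by (simp add: e1_def X1_def diff algebra_simps)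
  qed
  \<comment> \<open>Now f X1 and z both have curvature in F_(n+1), so their difference is a
    cocycle.\<close>
  have "f X1 + e1 = z" by (simp add: e1_def)
  then have "- (H.curvature (f X1) + brk H (f X1) e1) \<in> fil H (Suc n)"
    using H.curvature_add_approx[OF fX1(1) e1(2) n] by (simp add: z_curv)
  from H.fil_diff[OF H.fil_diff[OF H.fil_neg[OF this] map_fil[OF curv1]]
      H.brk_base_change[OF fX1(2) e1(2)]]
  have "brk H (f x) e1 \<in> fil H (Suc n)"
    by (simp add: map_curvature)
  then obtain c k where c: "c \<in> fil G n" "c \<in> gr G 0" "brk G x c \<in> fil G (Suc n)"
    and k: "k \<in> fil H n" "k \<in> gr H 1" "e1 - f c - brk H (f x) k \<in> fil H (Suc n)"
    using cohomology_surj[OF n e1(2,1)] by auto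
  \<comment> \<open>Adding the cocycle c leaves the curvature in F_(n+1); the coboundary {f x, k} is
    removed by letting exp(-k) act on z.\<close>
  show ?thesis
  proof
    show "X1 + c \<in> gr G 0" using X1 c by (auto intro: G.gr_mem)
    show "X1 + c - X \<in> fil G n"
      using G.fil_diff[OF c(1) b(1)] by (simp add: X1_def algebra_simps)
    show "G.curvature (X1 + c) \<in> fil G (Suc n)"
      using G.fil_add[OF G.fil_add[OF G.fil_add[OF G.curvature_add_approx[OF X1(1) c(1) n]
            G.brk_base_change[OF X1(2) c(1)]] c(3)] curv1]
      by simp
    show "- k \<in> fil H n" "- k \<in> gr H 1"
      using k by (auto intro: H.fil_neg H.gr_mem)
    have "z - f x \<in> fil H 1"
      using H.fil_add[OF H.fil_mono[OF z(2) n] fX(2)] by simp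
    then have zk: "brk H z k - brk H (f x) k \<in> fil H (Suc n)"
      by (rule H.brk_base_change[OF _ k(1)])
    have "gauge_act H (- k) z - (z - brk H z k) \<in> fil H (Suc n)"
      using H.gauge_linear_approx[OF n \<open>- k \<in> fil H n\<close>, of z] H.brk_even_sym[OF z0, of k]
      by (simp add: H.brk_simps)
    from H.fil_add[OF H.fil_diff[OF this zk] k(3)]
    show "gauge_act H (- k) z - f (X1 + c) \<in> fil H (Suc n)"
      by (simp add: e1_def add algebra_simps)
  qed
qed

lemma moduli_surj:
  assumes z: "z \<in> MC H" "z - f x \<in> fil H 1" and curv: "G.curvature x \<in> fil G 1"
  obtains X where "X \<in> MC G" "X - x \<in> fil G 1" "(z, f X) \<in> gauge_rel H"
proof -
  \<comment> \<open>A state pairs an approximate solution with one exponent acting on the original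
    z. Index n means accuracy F_(n+1), so x with exponent 0 is a start at n = 0.\<close>
  define P where "P n S \<longleftrightarrow> fst S \<in> gr G 0 \<and> fst S - x \<in> fil G 1 \<and> G.curvature (fst S) \<in> fil G (Suc n) \<and>
      snd S \<in> fil H 1 \<and> snd S \<in> gr H 1 \<and> gauge_act H (snd S) z - f (fst S) \<in> fil H (Suc n)"
    for n S
  define Q where "Q n S T \<longleftrightarrow> fst T - fst S \<in> fil G n \<and> snd T - snd S \<in> fil H n" for n S T
  have "\<exists>s. \<forall>n. P n (s n) \<and> Q n (s n) (s (Suc n))"
  proof (rule dependent_nat_choice)
    show "\<exists>S. P 0 S"
      using z curv x_even
      by (intro exI[of _ "(x, 0)"]) (auto simp: P_def H.gauge_zero G.fil_zero H.fil_zero H.gr_mem)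
    fix S n assume S: "P n S"
    obtain X w where Xw: "S = (X, w)" by (cases S)
    have X: "X \<in> gr G 0" "X - x \<in> fil G 1" "G.curvature X \<in> fil G (Suc n)"
      and w: "w \<in> fil H 1" "w \<in> gr H 1" "gauge_act H w z - f X \<in> fil H (Suc n)"
      using S by (auto simp: P_def Xw)
    obtain X' y where X': "X' \<in> gr G 0" "X' - X \<in> fil G (Suc n)" "G.curvature X' \<in> fil G (Suc (Suc n))"
      and y: "y \<in> fil H (Suc n)" "y \<in> gr H 1"
        "gauge_act H y (gauge_act H w z) - f X' \<in> fil H (Suc (Suc n))"
      using lifting_step[OF _ X H.gauge_MC[OF z(1) w(1,2)] w(3)] by auto
    \<comment> \<open>The composite is stored as a single exponent, which differs from w by y and
      deeper terms, hence by an element of F_(n+1).\<close>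
    obtain w' where w': "w' \<in> fil H 1" "w' \<in> gr H 1" "w' - (y + w) \<in> fil H (Suc (Suc n))"
      "\<And>v. gauge_act H w' v = gauge_act H y (gauge_act H w v)"
      using H.gauge_comp[OF _ y(1,2) w(1,2)] by auto
    have "P (Suc n) (X', w')"
      using X' y(3) w' G.fil_add[OF G.fil_mono[OF X'(2), of 1] X(2)] by (simp add: P_def)
    moreover have "Q n S (X', w')"
      using G.fil_mono[OF X'(2), of n]
        H.fil_add[OF H.fil_mono[OF w'(3), of n] H.fil_mono[OF y(1), of n]]
      by (simp add: Q_def Xw)
    ultimately show "\<exists>T. P (Suc n) T \<and> Q n S T" by blast
  qed
  then obtain s where P: "\<And>n. P n (s n)" and Q: "\<And>n. Q n (s n) (s (Suc n))" by blast
  obtain X where X: "\<And>n. X - fst (s n) \<in> fil G n"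
    by (rule G.fil_limit[of "\<lambda>n. fst (s n)"]) (use Q in \<open>auto simp: Q_def\<close>)
  obtain w where w: "\<And>n. w - snd (s n) \<in> fil H n"
    by (rule H.fil_limit[of "\<lambda>n. snd (s n)"]) (use Q in \<open>auto simp: Q_def\<close>)
  have X_even: "X \<in> gr G 0"
    by (rule G.gr_limit[OF _ X]) (use P in \<open>simp add: P_def\<close>)
  have w_odd: "w \<in> gr H 1"
    by (rule H.gr_limit[OF _ w]) (use P in \<open>simp add: P_def\<close>)
  have w1: "w \<in> fil H 1"
    using H.fil_add[OF w[of 1], of "snd (s 1)"] P[of 1] by (simp add: P_def)
  have "G.curvature X \<in> fil G n" for n
  proof -
    have "G.curvature (fst (s n)) \<in> fil G n" "fst (s n) \<in> gr G 0"
      using P[of n] G.fil_decreasing by (auto simp: P_def)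
    from G.fil_add[OF G.curvature_add_fil[OF this(2) X] this(1)] show ?thesis by simp
  qed
  then have "X \<in> MC G"
    using X_even G.zero_if_fil by (simp add: G.MC_iff)
  moreover have "X - x \<in> fil G 1"
    using G.fil_add[OF X[of 1], of "fst (s 1) - x"] P[of 1] by (simp add: P_def)
  moreover have "gauge_act H w z - f X \<in> fil H n" for n
  proof -
    have "gauge_act H (snd (s n)) z - f (fst (s n)) \<in> fil H n" "snd (s n) \<in> fil H 1"
      using P[of n] H.fil_decreasing by (auto simp: P_def)
    from H.fil_diff[OF H.fil_add[OF H.gauge_continuous[OF w1 this(2) w, of z] this(1)] map_fil[OF X]]
    show ?thesis by (simp add: diff)
  qed
  then have "gauge_act H w z - f X = 0" by (rule H.zero_if_fil)
  then have "(z, f X) \<in> gauge_rel H"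
    using z(1) w1 w_odd by (auto simp: H.gauge_rel_iff intro!: bexI[of _ w])
  ultimately show ?thesis using that by blast
qed

section \<open>Injectivity on moduli\<close>

text \<open>Unlike in \<open>lifting_step\<close>, the gauge equation in h holds exactly at every
  stage; what improves is the depth of its exponent.\<close>

lemma gauge_lifting_step:
  assumes n: "1 \<le> n"
    and X: "X \<in> MC G" "X - x \<in> fil G 1" and Y: "Y \<in> MC G" "Y - X \<in> fil G n"
    and h: "h \<in> fil H n" "h \<in> gr H 1" "gauge_act H h (f X) = f Y"
  obtains b h' where "b \<in> fil G n" "b \<in> gr G 1" "Y - gauge_act G b X \<in> fil G (Suc n)"
    and "h' \<in> fil H (Suc n)" "h' \<in> gr H 1" "gauge_act H h' (f (gauge_act G b X)) = f Y"
proof -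
  define e where "e = Y - X"
  have even: "X \<in> gr G 0" "Y \<in> gr G 0" and curv: "G.curvature X = 0" "G.curvature Y = 0"
    using X Y by (auto simp: G.MC_iff)
  have e: "e \<in> fil G n" "e \<in> gr G 0"
    using Y even by (auto simp: e_def intro: G.gr_mem)
  have fX: "f X \<in> gr H 0" "f X - f x \<in> fil H 1"
    by (intro map_gr map_base_change X even)+
  have "Y - x \<in> fil G 1"
    using G.fil_add[OF G.fil_mono[OF Y(2) n] X(2)] by simp
  then have fY: "f Y - f x \<in> fil H 1" by (rule map_base_change)
  have "X + e = Y" by (simp add: e_def)
  then have "- brk G X e \<in> fil G (Suc n)"
    using G.curvature_add_approx[OF even(1) e(1) n] by (simp add: curv)
  from G.fil_diff[OF G.fil_neg[OF this] G.brk_base_change[OF X(2) e(1)]]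
  have xe: "brk G x e \<in> fil G (Suc n)" by simp
  \<comment> \<open>To first order the gauge equation says that f e is the coboundary of h, so
    injectivity supplies a primitive b of e.\<close>
  have "f Y - (f X + brk H (f X) h) \<in> fil H (Suc n)"
    using H.gauge_linear_approx[OF n h(1), of "f X"] H.brk_even_sym[OF fX(1), of h] by (simp add: h)
  from H.fil_add[OF this H.brk_base_change[OF fX(2) h(1)]]
  have fe: "f e - brk H (f x) h \<in> fil H (Suc n)"
    by (simp add: e_def diff algebra_simps)
  obtain b where b: "b \<in> fil G n" "b \<in> gr G 1" "e - brk G x b \<in> fil G (Suc n)"
    using cohomology_inj[OF n e xe h(1) _ fe] h(2) by auto
  \<comment> \<open>h and f b are both primitives of f e, so they differ by a cocycle. Surjectivity
    then corrects b by a cocycle c so that f (b + c) agrees with h up to the coboundary of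
    k.\<close>
  have hb: "h - f b \<in> fil H n" "h - f b \<in> gr H 1"
    using h b by (auto intro: H.fil_diff H.gr_mem map_fil map_gr)
  have "brk H (f x) (h - f b) \<in> fil H (Suc n)"
    using H.fil_diff[OF map_fil[OF b(3)] fe] by (simp add: diff map_brk H.brk_simps)
  then obtain c k where c: "c \<in> fil G n" "c \<in> gr G 1" "brk G x c \<in> fil G (Suc n)"
    and k: "k \<in> fil H n" "k \<in> gr H 0" "h - f b - f c - brk H (f x) k \<in> fil H (Suc n)"
    using cohomology_surj[OF n hb] by auto
  define b' where "b' = b + c"
  have b': "b' \<in> fil G n" "b' \<in> gr G 1"
    using b c by (auto simp: b'_def intro: G.fil_add G.gr_mem)
  have b'1: "b' \<in> fil G 1" using G.fil_mono[OF b'(1) n] .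
  \<comment> \<open>q agrees with {f x, k} modulo F_(n+1), but is the full twisted differential at f
    Y: exp(-q) is applied last and must fix f Y exactly.\<close>
  define q where "q = dif H k + brk H (f Y) k"
  have q_fil: "q \<in> fil H n"
    unfolding q_def using k H.fil_dif_Suc[OF k(1)] H.fil_decreasing
    by (blast intro: H.fil_add H.fil_brk_right)
  have q_odd: "q \<in> gr H 1"
    unfolding q_def using k H.dif_odd[of k 0] H.brk_odd[of "f Y" 0 k 0] even map_gr[of Y 0]
    by (auto intro: H.gr_mem)
  have qk: "q - brk H (f x) k \<in> fil H (Suc n)"
    using H.fil_add[OF H.fil_dif_Suc[OF k(1)] H.brk_base_change[OF fY k(1)]] by (simp add: q_def add_diff_eq)
  have q_fix: "gauge_act H (- q) (f Y) = f Y"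
    using H.twisted_dif_square[OF map_MC[OF Y(1)] k(2)] unfolding q_def[symmetric]
    by (intro H.gauge_fix) (simp add: H.dif_simps H.brk_simps add_eq_0_iff)
  obtain h1 where h1: "h1 \<in> fil H 1" "h1 \<in> gr H 1" "h1 - (h + - f b') \<in> fil H (Suc n)"
    "\<And>v. gauge_act H h1 v = gauge_act H h (gauge_act H (- f b') v)"
    using H.gauge_comp[OF n h(1,2), of "- f b'"] b'(2) map_fil[OF b'1]
    by (auto intro: H.fil_neg H.gr_mem map_gr)
  \<comment> \<open>h' is the exponent of exp(-q) exp h exp(-f b'). Modulo F_(n+1) it is h - f b' -
    q, which vanishes by the choice of c and k.\<close>
  obtain h' where h': "h' \<in> fil H 1" "h' \<in> gr H 1" "h' - (- q + h1) \<in> fil H (Suc n)"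
    "\<And>v. gauge_act H h' v = gauge_act H (- q) (gauge_act H h1 v)"
    using H.gauge_comp[OF n _ _ h1(1,2), of "- q"] q_fil q_odd
    by (auto intro: H.fil_neg H.gr_mem)
  show ?thesis
  proof
    have "brk G b' X = brk G X b'" using G.brk_even_sym[OF even(1)] by simp
    then have "gauge_act G b' X - (X + brk G X b') \<in> fil G (Suc n)"
      using G.gauge_linear_approx[OF n b'(1), of X] by simp
    from G.fil_diff[OF G.fil_diff[OF G.fil_diff[OF b(3) c(3)] this] G.brk_base_change[OF X(2) b'(1)]]
    show "Y - gauge_act G b' X \<in> fil G (Suc n)"
      by (simp add: e_def b'_def G.brk_simps algebra_simps)
    show "h' \<in> fil H (Suc n)"
      using H.fil_diff[OF H.fil_add[OF H.fil_add[OF h'(3) h1(3)] k(3)] qk]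
      by (simp add: b'_def add algebra_simps)
    have "gauge_act H (- f b') (f (gauge_act G b' X)) = f X"
      using H.gauge_inverse[of "- f b'" "f X"] map_fil[OF b'1] map_gr[OF b'(2)] b'1
      by (simp add: map_gauge H.fil_neg H.gr_mem)
    then show "gauge_act H h' (f (gauge_act G b' X)) = f Y"
      by (simp add: h' h1 h q_fix)
  qed (fact b' h')+
qed

lemma moduli_inj:
  assumes X: "X \<in> MC G" "X - x \<in> fil G 1" and Y: "Y \<in> MC G" "Y - x \<in> fil G 1"
    and rel: "(f X, f Y) \<in> gauge_rel H"
  shows "(X, Y) \<in> gauge_rel G"
proof -
  obtain h where h: "h \<in> fil H 1" "h \<in> gr H 1" "gauge_act H h (f X) = f Y"
    using rel by (auto simp: H.gauge_rel_iff)
  \<comment> \<open>The first component accumulates the gauge transformation of g. The second is the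
    transformation of h still to be realised; it only shrinks, so \<open>Q\<close> controls the
    first component alone.\<close>
  define P where "P n S \<longleftrightarrow> fst S \<in> fil G 1 \<and> fst S \<in> gr G 1 \<and>
      Y - gauge_act G (fst S) X \<in> fil G (Suc n) \<and>
      snd S \<in> fil H (Suc n) \<and> snd S \<in> gr H 1 \<and>
      gauge_act H (snd S) (f (gauge_act G (fst S) X)) = f Y" for n S
  define Q where "Q n S T \<longleftrightarrow> fst T - fst S \<in> fil G n" for n and S T :: "'a \<times> 'b"
  have "\<exists>s. \<forall>n. P n (s n) \<and> Q n (s n) (s (Suc n))"
  proof (rule dependent_nat_choice)
    show "\<exists>S. P 0 S"
      using h G.fil_diff[OF Y(2) X(2)]
      by (intro exI[of _ "(0, h)"]) (auto simp: P_def G.gauge_zero G.fil_zero G.gr_mem)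
    fix S n assume S: "P n S"
    obtain g u where gu: "S = (g, u)" by (cases S)
    have g: "g \<in> fil G 1" "g \<in> gr G 1" "Y - gauge_act G g X \<in> fil G (Suc n)"
      and u: "u \<in> fil H (Suc n)" "u \<in> gr H 1" "gauge_act H u (f (gauge_act G g X)) = f Y"
      using S by (auto simp: P_def gu)
    have gX: "gauge_act G g X - x \<in> fil G 1"
      using G.fil_add[OF G.gauge_diff_fil[OF _ g(1), of X] X(2)] by simp
    obtain b u' where b: "b \<in> fil G (Suc n)" "b \<in> gr G 1"
        "Y - gauge_act G b (gauge_act G g X) \<in> fil G (Suc (Suc n))"
      and u': "u' \<in> fil H (Suc (Suc n))" "u' \<in> gr H 1"
        "gauge_act H u' (f (gauge_act G b (gauge_act G g X))) = f Y"
      using gauge_lifting_step[OF _ G.gauge_MC[OF X(1) g(1,2)] gX Y(1) g(3) u] by auto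
    obtain g' where g': "g' \<in> fil G 1" "g' \<in> gr G 1" "g' - (b + g) \<in> fil G (Suc (Suc n))"
      "\<And>v. gauge_act G g' v = gauge_act G b (gauge_act G g v)"
      using G.gauge_comp[OF _ b(1,2) g(1,2)] by auto
    have "P (Suc n) (g', u')"
      using g' u' b by (simp add: P_def)
    moreover have "Q n S (g', u')"
      using G.fil_add[OF G.fil_mono[OF g'(3), of n] G.fil_mono[OF b(1), of n]]
      by (simp add: Q_def gu)
    ultimately show "\<exists>T. P (Suc n) T \<and> Q n S T" by blast
  qed
  then obtain s where P: "\<And>n. P n (s n)" and Q: "\<And>n. Q n (s n) (s (Suc n))" by blast
  obtain g where g: "\<And>n. g - fst (s n) \<in> fil G n"
    by (rule G.fil_limit[of "\<lambda>n. fst (s n)"]) (use Q in \<open>auto simp: Q_def\<close>)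
  have g_odd: "g \<in> gr G 1"
    by (rule G.gr_limit[OF _ g]) (use P in \<open>simp add: P_def\<close>)
  have g1: "g \<in> fil G 1"
    using G.fil_add[OF g[of 1], of "fst (s 1)"] P[of 1] by (simp add: P_def)
  have "Y - gauge_act G g X \<in> fil G n" for n
  proof -
    have "Y - gauge_act G (fst (s n)) X \<in> fil G n" "fst (s n) \<in> fil G 1"
      using P[of n] G.fil_decreasing by (auto simp: P_def)
    from G.fil_diff[OF this(1) G.gauge_continuous[OF g1 this(2) g, of X]] show ?thesis by simp
  qed
  then have "Y - gauge_act G g X = 0" by (rule G.zero_if_fil)
  then show ?thesis
    using X(1) g1 g_odd by (auto simp: G.gauge_rel_iff intro!: bexI[of _ g])
qed

section \<open>Descent to orbits and conclusion\<close>

lemma map_gauge_rel: "(X, Y) \<in> gauge_rel G \<Longrightarrow> (f X, f Y) \<in> gauge_rel H"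
  by (auto simp: G.gauge_rel_iff H.gauge_rel_iff map_MC map_gauge simp del: One_nat_def
      intro!: bexI[of _ "f _"] map_fil map_gr)

text \<open>\<open>moduli_map\<close> takes the union of the orbits of all f Y with Y in the class;
  as f respects gauge equivalence, these orbits coincide.\<close>

lemma moduli_map_class:
  assumes "X \<in> MC G"
  shows "moduli_map H f (gauge_rel G `` {X}) = gauge_rel H `` {f X}"
proof -
  have "f X \<in> f ` (gauge_rel G `` {X})"
    using equiv_class_self[OF G.equiv_gauge_rel assms] by blast
  moreover have "gauge_rel H `` {f Y} = gauge_rel H `` {f X}" if "(X, Y) \<in> gauge_rel G" for Y
    using equiv_class_eq[OF H.equiv_gauge_rel map_gauge_rel[OF that]] by simp
  ultimately show ?thesis
    unfolding moduli_map_def by blast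
qed

theorem moduli_map_bij:
  assumes curv: "G.curvature x \<in> fil G 1"
  shows "bij_betw (moduli_map H f) (MC_moduli G (x +o fil G 1)) (MC_moduli H (f x +o fil H 1))"
  unfolding bij_betw_def
proof
  show "inj_on (moduli_map H f) (MC_moduli G (x +o fil G 1))"
  proof (rule inj_onI)
    fix C D assume C: "C \<in> MC_moduli G (x +o fil G 1)" and D: "D \<in> MC_moduli G (x +o fil G 1)"
      and eq: "moduli_map H f C = moduli_map H f D"
    obtain X Y where X: "X \<in> MC G" "X - x \<in> fil G 1" "C = gauge_rel G `` {X}"
      and Y: "Y \<in> MC G" "Y - x \<in> fil G 1" "D = gauge_rel G `` {Y}"
      using C D unfolding MC_moduli_def quotient_def by (auto simp: G.MC_fiber_iff simp del: One_nat_def)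
    have "(f X, f Y) \<in> gauge_rel H"
      using eq eq_equiv_class[OF _ H.equiv_gauge_rel map_MC[OF Y(1)]]
      by (simp add: X(3) Y(3) moduli_map_class X(1) Y(1))
    then have "(X, Y) \<in> gauge_rel G" by (rule moduli_inj[OF X(1,2) Y(1,2)])
    then show "C = D"
      unfolding X(3) Y(3) by (rule equiv_class_eq[OF G.equiv_gauge_rel])
  qed
  show "moduli_map H f ` MC_moduli G (x +o fil G 1) = MC_moduli H (f x +o fil H 1)"
  proof
    show "moduli_map H f ` MC_moduli G (x +o fil G 1) \<subseteq> MC_moduli H (f x +o fil H 1)"
    proof
      fix D assume "D \<in> moduli_map H f ` MC_moduli G (x +o fil G 1)"
      then obtain X where X: "X \<in> MC G" "X - x \<in> fil G 1" and "D = moduli_map H f (gauge_rel G `` {X})"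
        unfolding MC_moduli_def quotient_def by (auto simp: G.MC_fiber_iff simp del: One_nat_def)
      then have "D = gauge_rel H `` {f X}" by (simp add: moduli_map_class)
      moreover have "f X \<in> MC_fiber H (f x +o fil H 1)"
        unfolding H.MC_fiber_iff by (intro conjI map_MC map_base_change X)
      ultimately show "D \<in> MC_moduli H (f x +o fil H 1)"
        unfolding MC_moduli_def by (simp add: quotientI)
    qed
    show "MC_moduli H (f x +o fil H 1) \<subseteq> moduli_map H f ` MC_moduli G (x +o fil G 1)"
    proof
      fix D assume "D \<in> MC_moduli H (f x +o fil H 1)"
      then obtain z where z: "z \<in> MC H" "z - f x \<in> fil H 1" "D = gauge_rel H `` {z}"
        unfolding MC_moduli_def quotient_def by (auto simp: H.MC_fiber_iff simp del: One_nat_def)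
      obtain X where X: "X \<in> MC G" "X - x \<in> fil G 1" "(z, f X) \<in> gauge_rel H"
        using moduli_surj[OF z(1,2) curv] .
      have "D = moduli_map H f (gauge_rel G `` {X})"
        unfolding z(3) moduli_map_class[OF X(1)] by (rule equiv_class_eq[OF H.equiv_gauge_rel X(3)])
      moreover have "gauge_rel G `` {X} \<in> MC_moduli G (x +o fil G 1)"
        unfolding MC_moduli_def by (rule quotientI) (simp only: G.MC_fiber_iff X(1,2) simp_thms)
      ultimately show "D \<in> moduli_map H f ` MC_moduli G (x +o fil G 1)" by blast
    qed
  qed
qed

end

theorem theorem6p23:
  fixes G :: "('k::field_char_0, 'a::ab_group_add) filtered_dgla"
    and H :: "('k, 'b::ab_group_add) filtered_dgla"
    and \<Phi> :: "'a \<Rightarrow> 'b" and x0 :: "'a set" and x0' :: "'b set"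
  assumes "strongly_filtered_dgla G" and "strongly_filtered_dgla H"
    and "filtered_dgla_map G H \<Phi>"
    and "x0 \<in> MC_classical G"
    and "x0' = induced \<Phi> (fil H 1) x0"
    and "\<And>m i. m \<ge> 1 \<Longrightarrow>
      bij_betw (gr_cohomology_map H \<Phi> x0' m i) (gr_cohomology G x0 m i) (gr_cohomology H x0' m i)"
  shows "bij_betw (moduli_map H \<Phi>) (MC_moduli G x0) (MC_moduli H x0')"
proof -
  interpret filtered_dgla_map G H \<Phi> by fact
  obtain x where x: "x \<in> gr G 0" "x0 = x +o fil G 1"
    and flat: "quot_brk G (fil G 1) x0 x0 = fil G 1"
    using assms(4) by (auto simp: MC_classical_def quot_def)
  have x0': "x0' = \<Phi> x +o fil H 1"
    unfolding assms(5) x(2) by (rule induced_coset)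
  interpret graded_quasi_isomorphism G H \<Phi> x
    by unfold_locales (use x(1) assms(6) in \<open>simp_all only: x(2) x0'\<close>)
  \<comment> \<open>The coset formula at m = 0, where F_0 is everything, puts {x,x} into F_1. Since
    dx lies in F_1 as well, the iteration can start from x.\<close>
  have "brk G x x +o fil G 1 = 0 +o fil G 1"
    using flat G.quot_brk_coset[of x 0 x] by (simp add: x(2) G.fil_0 elt_set_plus_def)
  then have "brk G x x \<in> fil G 1"
    unfolding G.coset_eq_iff by simp
  then have "G.curvature x \<in> fil G 1"
    unfolding G.curvature_def using G.fil_dif_Suc[of x 0]
    by (auto intro: G.fil_add G.fil_scale simp: G.fil_0)
  then show ?thesis
    unfolding x(2) x0' by (rule moduli_map_bij)
qed

end
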